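(* Let $(M,d,\mu)$ be a metric measure space and $(\mathcal{E},\mathcal{F})$ a Dirichlet form on $L^2(M,\mu)$ with extended Dirichlet space $\mathcal{F}_e$. For every $1<q<\infty$, the space $V^q:=L^q(M,\mu)\cap\mathcal{F}_e$ with the norm $\|u\|_{V^q}:=\left(\|u\|_{L^q}^2+\mathcal{E}(u)\right)^{1/2}$ is uniformly convex.
   Context: A metric measure space $(M,d,\mu)$ is a locally compact, separable metric space $(M,d)$ with a Radon measure $\mu$ of full support. $L^q:=L^q(M,\mu)$ (real-valued). A Dirichlet form $(\mathcal{E},\mathcal{F})$ on $L^2(M,\mu)$ is a symmetric non-negative bilinear form $\mathcal{E}$ with domain $\mathcal{F}$ dense in $L^2(M,\mu)$, such that $\mathcal{F}$ is a Hilbert space with inner product $(u,v)_{L^2}+\mathcal{E}(u,v)$, and such that for every $u\in\mathcal{F}$ the function $\bar u:=(u\vee0)\wedge1$ belongs to $\mathcal{F}$ with $\mathcal{E}(\bar u,\bar u)\le\mathcal{E}(u,u)$. Write $\mathcal{E}(u):=\mathcal{E}(u,u)$. Extended Dirichlet space: $\mathcal{F}_e$ is the set of all measurable functions $u$ on $M$ (identified when equal $\mu$-a.e.) for which there is an $\mathcal{E}$-Cauchy sequence $\{u_k\}\subset\mathcal{F}$ (i.e. $\mathcal{E}(u_k-u_l)\to0$ as $k,l\to\infty$) with $u_k\to u$ $\mu$-a.e.; then $\mathcal{E}(u,u):=\lim_k\mathcal{E}(u_k,u_k)$, which does not depend on the sequence chosen, and $\mathcal{E}$ is extended to a bilinear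 form on $\mathcal{F}_e$ by polarization. A normed space is uniformly convex if for every $\varepsilon>0$ there is $\delta>0$ such that $\|v\|=\|w\|=1$ and $\|v-w\|>\varepsilon$ imply $\|(v+w)/2\|\le1-\delta$. *)

theory Defs
  imports "HOL-Analysis.Analysis"
begin

text \<open>
  Elements of the function spaces below (\<open>L\<^sup>q\<close>, the domain of a Dirichlet form, its extended
  domain) are represented by real-valued Borel functions. Two functions that agree almost
  everywhere represent the same element, so equality of elements is always \<open>AE\<close>-equality.
\<close>


subsection \<open>Metric measure spaces\<close>

definition radon_measure :: "'a::topological_space measure \<Rightarrow> bool" where
  "radon_measure \<mu> \<longleftrightarrow>
     sets \<mu> = sets borel \<and>
     (\<forall>K. compact K \<longrightarrow> emeasure \<mu> K < \<infinity>) \<and>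
     (\<forall>A \<in> sets borel. emeasure \<mu> A = (INF U \<in> {U. open U \<and> A \<subseteq> U}. emeasure \<mu> U)) \<and>
     (\<forall>U. open U \<longrightarrow> emeasure \<mu> U = (SUP K \<in> {K. compact K \<and> K \<subseteq> U}. emeasure \<mu> K))"

definition full_support :: "'a::topological_space measure \<Rightarrow> bool" where
  "full_support \<mu> \<longleftrightarrow> (\<forall>U. open U \<and> U \<noteq> {} \<longrightarrow> emeasure \<mu> U > 0)"

text \<open>The underlying metric space is the type \<open>'a\<close> with its distance \<open>dist\<close>.\<close>

locale metric_measure_space =
  fixes \<mu> :: "'a::metric_space measure"
  assumes locally_compact: "locally_compact_space (euclidean :: 'a topology)"
    and separable: "separable_space (euclidean :: 'a topology)"
    and radon: "radon_measure \<mu>"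
    and full_support: "full_support \<mu>"


subsection \<open>Function spaces modulo almost-everywhere equality\<close>

definition linear_function_space :: "('a \<Rightarrow> real) set \<Rightarrow> bool" where
  "linear_function_space V \<longleftrightarrow>
     (\<lambda>x. 0) \<in> V \<and>
     (\<forall>u \<in> V. \<forall>v \<in> V. (\<lambda>x. u x + v x) \<in> V) \<and>
     (\<forall>c. \<forall>u \<in> V. (\<lambda>x. c * u x) \<in> V)"

text \<open>
  \<open>N\<close> induces a norm on the quotient of \<open>V\<close> by \<open>AE\<close>-equality. That \<open>N\<close> takes equal values on
  \<open>AE\<close>-equal functions follows from the triangle inequality and the clause on \<open>N u = 0\<close>.
\<close>

definition normed_function_space ::
    "'a measure \<Rightarrow> ('a \<Rightarrow> real) set \<Rightarrow> (('a \<Rightarrow> real) \<Rightarrow> real) \<Rightarrow> bool" where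
  "normed_function_space \<mu> V N \<longleftrightarrow>
     V \<subseteq> borel_measurable \<mu> \<and> linear_function_space V \<and>
     (\<forall>u \<in> V. 0 \<le> N u) \<and>
     (\<forall>u \<in> V. N u = 0 \<longleftrightarrow> (AE x in \<mu>. u x = 0)) \<and>
     (\<forall>c. \<forall>u \<in> V. N (\<lambda>x. c * u x) = \<bar>c\<bar> * N u) \<and>
     (\<forall>u \<in> V. \<forall>v \<in> V. N (\<lambda>x. u x + v x) \<le> N u + N v)"

definition uniformly_convex_function_space ::
    "'a measure \<Rightarrow> ('a \<Rightarrow> real) set \<Rightarrow> (('a \<Rightarrow> real) \<Rightarrow> real) \<Rightarrow> bool" where
  "uniformly_convex_function_space \<mu> V N \<longleftrightarrow>
     normed_function_space \<mu> V N \<and>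
     (\<forall>\<epsilon>>0. \<exists>\<delta>>0. \<forall>v \<in> V. \<forall>w \<in> V.
        N v = 1 \<and> N w = 1 \<and> N (\<lambda>x. v x - w x) > \<epsilon> \<longrightarrow>
        N (\<lambda>x. (v x + w x) / 2) \<le> 1 - \<delta>)"

definition Lq_space :: "'a measure \<Rightarrow> real \<Rightarrow> ('a \<Rightarrow> real) set" where
  "Lq_space \<mu> q = {u \<in> borel_measurable \<mu>. integrable \<mu> (\<lambda>x. \<bar>u x\<bar> powr q)}"

definition Lq_norm :: "'a measure \<Rightarrow> real \<Rightarrow> ('a \<Rightarrow> real) \<Rightarrow> real" where
  "Lq_norm \<mu> q u = (\<integral>x. \<bar>u x\<bar> powr q \<partial>\<mu>) powr (1 / q)"


subsection \<open>Dirichlet forms\<close>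

definition form_cauchy ::
    "(('a \<Rightarrow> real) \<Rightarrow> ('a \<Rightarrow> real) \<Rightarrow> real) \<Rightarrow> (nat \<Rightarrow> 'a \<Rightarrow> real) \<Rightarrow> bool" where
  "form_cauchy B U \<longleftrightarrow>
     (\<forall>\<epsilon>>0. \<exists>n. \<forall>k\<ge>n. \<forall>l\<ge>n. B (\<lambda>x. U k x - U l x) (\<lambda>x. U k x - U l x) < \<epsilon>)"

definition energy_inner ::
    "'a measure \<Rightarrow> (('a \<Rightarrow> real) \<Rightarrow> ('a \<Rightarrow> real) \<Rightarrow> real) \<Rightarrow>
     ('a \<Rightarrow> real) \<Rightarrow> ('a \<Rightarrow> real) \<Rightarrow> real" where
  "energy_inner \<mu> \<E> u v = (\<integral>x. u x * v x \<partial>\<mu>) + \<E> u v"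

text \<open>
  The assumptions \<open>domain_ae\<close> and \<open>form_ae\<close> say that \<open>\<F>\<close> and \<open>\<E>\<close> are well defined on
  \<open>AE\<close>-classes. Given the other assumptions, \<open>energy_inner \<mu> \<E>\<close> is automatically an inner
  product modulo \<open>AE\<close>-equality, so only its completeness has to be required.
\<close>

locale dirichlet_form =
  fixes \<mu> :: "'a measure"
    and \<F> :: "('a \<Rightarrow> real) set"
    and \<E> :: "('a \<Rightarrow> real) \<Rightarrow> ('a \<Rightarrow> real) \<Rightarrow> real"
  assumes domain_L2: "\<F> \<subseteq> Lq_space \<mu> 2"
    and domain_ae:
      "\<lbrakk>u \<in> \<F>; v \<in> borel_measurable \<mu>; AE x in \<mu>. u x = v x\<rbrakk> \<Longrightarrow> v \<in> \<F>"
    and form_ae: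
      "\<lbrakk>u \<in> \<F>; u' \<in> \<F>; v \<in> \<F>; AE x in \<mu>. u x = u' x\<rbrakk> \<Longrightarrow> \<E> u v = \<E> u' v"
    and domain_linear: "linear_function_space \<F>"
    and domain_dense:
      "\<lbrakk>f \<in> Lq_space \<mu> 2; \<epsilon> > 0\<rbrakk> \<Longrightarrow> \<exists>u \<in> \<F>. Lq_norm \<mu> 2 (\<lambda>x. f x - u x) < \<epsilon>"
    and form_sym: "\<lbrakk>u \<in> \<F>; v \<in> \<F>\<rbrakk> \<Longrightarrow> \<E> u v = \<E> v u"
    and form_add:
      "\<lbrakk>u \<in> \<F>; v \<in> \<F>; w \<in> \<F>\<rbrakk> \<Longrightarrow> \<E> (\<lambda>x. u x + v x) w = \<E> u w + \<E> v w"
    and form_scale: "\<lbrakk>u \<in> \<F>; v \<in> \<F>\<rbrakk> \<Longrightarrow> \<E> (\<lambda>x. c * u x) v = c * \<E> u v"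
    and form_nonneg: "u \<in> \<F> \<Longrightarrow> 0 \<le> \<E> u u"
    and form_complete:
      "\<lbrakk>\<And>k. U k \<in> \<F>; form_cauchy (energy_inner \<mu> \<E>) U\<rbrakk> \<Longrightarrow>
       \<exists>u \<in> \<F>. (\<lambda>k. energy_inner \<mu> \<E> (\<lambda>x. U k x - u x) (\<lambda>x. U k x - u x)) \<longlonglongrightarrow> 0"
    and markov_domain: "u \<in> \<F> \<Longrightarrow> (\<lambda>x. min (max (u x) 0) 1) \<in> \<F>"
    and markov_form:
      "u \<in> \<F> \<Longrightarrow> \<E> (\<lambda>x. min (max (u x) 0) 1) (\<lambda>x. min (max (u x) 0) 1) \<le> \<E> u u"


subsection \<open>The extended Dirichlet space\<close>

definition approximating_sequence ::
    "'a measure \<Rightarrow> ('a \<Rightarrow> real) set \<Rightarrow> (('a \<Rightarrow> real) \<Rightarrow> ('a \<Rightarrow> real) \<Rightarrow> real) \<Rightarrow>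
     (nat \<Rightarrow> 'a \<Rightarrow> real) \<Rightarrow> ('a \<Rightarrow> real) \<Rightarrow> bool" where
  "approximating_sequence \<mu> \<F> \<E> U u \<longleftrightarrow>
     (\<forall>k. U k \<in> \<F>) \<and> form_cauchy \<E> U \<and> (AE x in \<mu>. (\<lambda>k. U k x) \<longlonglongrightarrow> u x)"

definition extended_domain ::
    "'a measure \<Rightarrow> ('a \<Rightarrow> real) set \<Rightarrow> (('a \<Rightarrow> real) \<Rightarrow> ('a \<Rightarrow> real) \<Rightarrow> real) \<Rightarrow>
     ('a \<Rightarrow> real) set" where
  "extended_domain \<mu> \<F> \<E> =
     {u \<in> borel_measurable \<mu>. \<exists>U. approximating_sequence \<mu> \<F> \<E> U u}"

text \<open>
  The description operator is justified by the classical fact that, for a Dirichlet form, the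
  limit exists and is the same for all approximating sequences of \<open>u\<close>.
\<close>

definition extended_energy ::
    "'a measure \<Rightarrow> ('a \<Rightarrow> real) set \<Rightarrow> (('a \<Rightarrow> real) \<Rightarrow> ('a \<Rightarrow> real) \<Rightarrow> real) \<Rightarrow>
     ('a \<Rightarrow> real) \<Rightarrow> real" where
  "extended_energy \<mu> \<F> \<E> u =
     (THE e. \<exists>U. approximating_sequence \<mu> \<F> \<E> U u \<and> (\<lambda>k. \<E> (U k) (U k)) \<longlonglongrightarrow> e)"

definition V_space ::
    "'a measure \<Rightarrow> ('a \<Rightarrow> real) set \<Rightarrow> (('a \<Rightarrow> real) \<Rightarrow> ('a \<Rightarrow> real) \<Rightarrow> real) \<Rightarrow> real \<Rightarrow>
     ('a \<Rightarrow> real) set" where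
  "V_space \<mu> \<F> \<E> q = Lq_space \<mu> q \<inter> extended_domain \<mu> \<F> \<E>"

definition V_norm ::
    "'a measure \<Rightarrow> ('a \<Rightarrow> real) set \<Rightarrow> (('a \<Rightarrow> real) \<Rightarrow> ('a \<Rightarrow> real) \<Rightarrow> real) \<Rightarrow> real \<Rightarrow>
     ('a \<Rightarrow> real) \<Rightarrow> real" where
  "V_norm \<mu> \<F> \<E> q u = sqrt ((Lq_norm \<mu> q u)\<^sup>2 + extended_energy \<mu> \<F> \<E> u)"

end

theory Submission
  imports Defs
begin

text \<open>
  The energy is a quadratic form, so on the space in question it satisfies the parallelogram
  identity exactly, and \<open>L\<^sup>q\<close> is uniformly convex for \<open>1 < q < \<infinity>\<close>. Combining the two in the
  Euclidean way keeps uniform convexity: if \<open>v\<close>, \<open>w\<close> have norm one and their midpoint has norm close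
  to one, then the parallelogram identity forces \<open>\<E>(v - w)\<close> to be small and the two
  \<open>L\<^sup>q\<close>-norms to be almost equal; the midpoint then loses almost nothing in \<open>L\<^sup>q\<close> either, and
  uniform convexity of \<open>L\<^sup>q\<close> makes \<open>v - w\<close> small there (\<open>V_norm_midpoint_le\<close>).

  For \<open>L\<^sup>q\<close> the quantitative input is the pointwise bound \<open>powr_difference_le_gap\<close>: the power
  \<open>\<bar>a - b\<bar>\<^sup>q\<close> is controlled by the defect in the midpoint convexity of \<open>t \<mapsto> \<bar>t\<bar>\<^sup>q\<close>, up to an
  arbitrarily small multiple of \<open>\<bar>a\<bar>\<^sup>q + \<bar>b\<bar>\<^sup>q\<close>. By homogeneity it is a statement about a compact
  set, where it follows from strict convexity, and it can be integrated as it stands.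

  The other half of the work is that the energy on the extended domain makes sense: the limit of
  \<open>\<E>(u\<^sub>k)\<close> is the same for all approximating sequences. This amounts to \<open>cauchy_null\<close>: an
  \<open>\<E>\<close>-Cauchy sequence \<open>u\<^sub>k \<in> \<F>\<close> that tends to \<open>0\<close> almost everywhere has energy tending to \<open>0\<close>.
  The argument rests on the contraction inequality
  \<open>\<E>(u\<^sup>+, u\<^sup>-) \<le> 0\<close>. If \<open>u\<^sub>k \<ge> 0\<close> and \<open>0 \<le> g \<in> \<F>\<close>, then \<open>u\<^sub>k \<and> g\<close> tends to \<open>0\<close> in
  \<open>L\<^sup>2\<close> by domination, hence \<open>\<E>\<close>-weakly, and
  \<open>\<E>(u\<^sub>k - u\<^sub>k \<and> g, g - u\<^sub>k \<and> g) \<le> 0\<close> gives \<open>limsup \<E>(u\<^sub>k, g) \<le> 0\<close>. Taking \<open>g = u\<^sub>m\<close> shows that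
  the limit has no energy. For \<open>u\<^sub>k\<close> of arbitrary sign, \<open>u\<^sub>k\<^sup>+\<close> and \<open>u\<^sub>k\<^sup>-\<close> are only bounded in energy,
  but suitable convex combinations of them are \<open>\<E>\<close>-Cauchy, which reduces to the non-negative case.

  Weak compactness is replaced throughout by \<open>minimizing_sequence\<close>: almost minimizers of a
  quadratic functional over decreasing convex sets form a Cauchy sequence.
\<close>

section \<open>Uniform convexity of the spaces of q-integrable functions\<close>

text \<open>
  The derivative \<open>t \<mapsto> q * t powr (q - 1)\<close> is strictly increasing because \<open>q > 1\<close>. The point \<open>s = 0\<close>,
  where the mean value theorem has to be applied up to the boundary, is included on purpose:
  it is what the values \<open>\<bar>u x\<bar>\<close> of a function require.
\<close>

lemma powr_above_tangent:
  fixes m s q :: real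
  assumes q: "1 < q" and m: "0 < m" and s: "0 \<le> s" and ne: "s \<noteq> m"
  shows "m powr q + q * m powr (q - 1) * (s - m) < s powr q"
proof -
  have cont: "continuous_on {a..b} (\<lambda>x. x powr q)" if "0 \<le> a" for a b :: real
    using q that by (intro continuous_on_powr') (auto intro: continuous_intros)
  have deriv: "((\<lambda>x. x powr q) has_real_derivative q * x powr (q - 1)) (at x)" if "0 < x" for x :: real
    using that by (auto intro!: derivative_eq_intros)
  have diff: "(\<lambda>x. x powr q) differentiable (at x)" if "0 < x" for x :: real
    using deriv[OF that] by (auto simp: real_differentiable_def)
  show ?thesis
  proof (cases "m < s")
    case True
    obtain l z where z: "m < z" "z < s"
        "DERIV (\<lambda>x. x powr q) z :> l" "s powr q - m powr q = (s - m) * l"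
      using MVT[OF True cont[of m s] diff] m by auto
    then have l: "l = q * z powr (q - 1)"
      using DERIV_unique[OF z(3) deriv] m by auto
    have "m powr (q - 1) < z powr (q - 1)"
      using q m z by (intro powr_less_mono2) auto
    then have "(s - m) * (q * m powr (q - 1)) < (s - m) * (q * z powr (q - 1))"
      using q True by (intro mult_strict_left_mono) auto
    then show ?thesis
      using z l by (simp add: algebra_simps)
  next
    case False
    then have less: "s < m" using ne by auto
    obtain l z where z: "s < z" "z < m"
        "DERIV (\<lambda>x. x powr q) z :> l" "m powr q - s powr q = (m - s) * l"
      using MVT[OF less cont[of s m] diff] s by auto
    then have l: "l = q * z powr (q - 1)"
      using DERIV_unique[OF z(3) deriv] s by auto
    have "z powr (q - 1) < m powr (q - 1)"
      using q s z by (intro powr_less_mono2) auto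
    then have "(m - s) * (q * z powr (q - 1)) < (m - s) * (q * m powr (q - 1))"
      using q less by (intro mult_strict_left_mono) auto
    then show ?thesis
      using z l by (simp add: algebra_simps)
  qed
qed

lemma powr_convex_combination:
  fixes s t \<theta> q :: real
  assumes q: "1 < q" and s: "0 \<le> s" and t: "0 \<le> t" and \<theta>: "0 \<le> \<theta>" "\<theta> \<le> 1"
  shows "(\<theta> * s + (1 - \<theta>) * t) powr q \<le> \<theta> * s powr q + (1 - \<theta>) * t powr q"
proof -
  define m where "m = \<theta> * s + (1 - \<theta>) * t"
  have m0: "0 \<le> m" unfolding m_def using assms by (intro add_nonneg_nonneg mult_nonneg_nonneg) auto
  show ?thesis
  proof (cases "m = 0")
    case True
    then show ?thesis unfolding m_def[symmetric] using \<theta> by simp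
  next
    case False
    define k where "k = q * m powr (q - 1)"
    have tan: "m powr q + k * (r - m) \<le> r powr q" if "0 \<le> r" for r
      using powr_above_tangent[OF q _ that, of m] m0 False unfolding k_def by (cases "r = m") auto
    have "\<theta> * (s - m) + (1 - \<theta>) * (t - m) = 0"
      by (simp add: m_def algebra_simps)
    then have "m powr q = m powr q + k * (\<theta> * (s - m) + (1 - \<theta>) * (t - m))"
      by simp
    also have "\<dots> = \<theta> * (m powr q + k * (s - m)) + (1 - \<theta>) * (m powr q + k * (t - m))"
      by (simp add: algebra_simps)
    also have "\<dots> \<le> \<theta> * s powr q + (1 - \<theta>) * t powr q"
      using \<theta> by (intro add_mono mult_left_mono tan s t) auto
    finally show ?thesis unfolding m_def .
  qed
qed

text \<open>
  The defect in the midpoint convexity of \<open>t \<mapsto> \<bar>t\<bar> powr q\<close>.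
\<close>

definition powr_gap :: "real \<Rightarrow> real \<Rightarrow> real \<Rightarrow> real" where
  "powr_gap q a b = (\<bar>a\<bar> powr q + \<bar>b\<bar> powr q) / 2 - \<bar>(a + b) / 2\<bar> powr q"

lemma powr_gap_nonneg:
  assumes "1 < q" shows "0 \<le> powr_gap q a b"
proof -
  have "\<bar>(a + b) / 2\<bar> powr q \<le> ((1/2) * \<bar>a\<bar> + (1 - 1/2) * \<bar>b\<bar>) powr q"
    using assms by (intro powr_mono2) auto
  also have "\<dots> \<le> (1/2) * \<bar>a\<bar> powr q + (1 - 1/2) * \<bar>b\<bar> powr q"
    using assms by (intro powr_convex_combination) auto
  finally show ?thesis unfolding powr_gap_def by simp
qed

text \<open>
  If \<open>\<bar>a\<bar> \<noteq> \<bar>b\<bar>\<close>, the two tangent inequalities at the mean of \<open>\<bar>a\<bar>\<close> and \<open>\<bar>b\<bar>\<close> are strict and their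
  linear parts cancel; otherwise \<open>a = - b\<close> and the midpoint is \<open>0\<close>.
\<close>

lemma powr_gap_pos:
  assumes q: "1 < q" and ne: "a \<noteq> b" shows "0 < powr_gap q a b"
proof (cases "\<bar>a\<bar> = \<bar>b\<bar>")
  case True
  then have "a = - b" "b \<noteq> 0" using ne by auto
  then show ?thesis unfolding powr_gap_def using q by simp
next
  case False
  define m where "m = (\<bar>a\<bar> + \<bar>b\<bar>) / 2"
  define k where "k = q * m powr (q - 1)"
  have m: "0 < m" "\<bar>a\<bar> \<noteq> m" "\<bar>b\<bar> \<noteq> m" using False unfolding m_def by auto
  have "\<bar>(a + b) / 2\<bar> powr q \<le> m powr q"
    using q unfolding m_def by (intro powr_mono2) auto
  moreover have "m powr q + k * (\<bar>a\<bar> - m) < \<bar>a\<bar> powr q" "m powr q + k * (\<bar>b\<bar> - m) < \<bar>b\<bar> powr q"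
    unfolding k_def using q m by (auto intro!: powr_above_tangent)
  moreover have "k * (\<bar>a\<bar> - m) + k * (\<bar>b\<bar> - m) = 0"
    unfolding distrib_left[symmetric] by (simp add: m_def)
  ultimately show ?thesis unfolding powr_gap_def by (simp add: field_simps)
qed

text \<open>
  Uniform convexity of \<open>\<real>\<close> in a form that can be integrated. All terms are homogeneous of degree
  \<open>q\<close>, so \<open>max \<bar>a\<bar> \<bar>b\<bar> = 1\<close> may be assumed. On the compact part of this set where
  \<open>\<bar>a - b\<bar> powr q\<close> uses up its allowance \<open>\<eta> * (\<bar>a\<bar> powr q + \<bar>b\<bar> powr q)\<close>, \<open>a \<noteq> b\<close>, so that the gap is bounded below there.
\<close>

lemma powr_difference_le_gap:
  fixes q \<eta> :: real
  assumes q: "1 < q" and \<eta>: "0 < \<eta>"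
  shows "\<exists>C\<ge>0. \<forall>a b. \<bar>a - b\<bar> powr q \<le> \<eta> * (\<bar>a\<bar> powr q + \<bar>b\<bar> powr q) + C * powr_gap q a b"
proof -
  define F where "F = (\<lambda>(a, b). \<bar>a - b\<bar> powr q - \<eta> * (\<bar>a\<bar> powr q + \<bar>b\<bar> powr q))"
  define G where "G = (\<lambda>(a, b). powr_gap q a b)"
  define K where "K = {p :: real \<times> real. max \<bar>fst p\<bar> \<bar>snd p\<bar> = 1 \<and> 0 \<le> F p}"
  have contF: "continuous_on UNIV F"
    unfolding F_def case_prod_beta using q
    by (intro continuous_intros continuous_on_powr') auto
  have contG: "continuous_on A G" for A
    unfolding G_def powr_gap_def case_prod_beta using q
    by (intro continuous_intros continuous_on_powr') auto
  have "closed K"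
    unfolding K_def using contF
    by (intro closed_Collect_conj closed_Collect_eq closed_Collect_le) (auto intro!: continuous_intros)
  moreover have "bounded K"
    by (rule bounded_subset[of "{-1..1} \<times> {-1..1}"]) (auto intro!: bounded_Times simp: K_def)
  ultimately have compact: "compact K" by (simp add: compact_eq_bounded_closed)
  have pos: "0 < G p" if "p \<in> K" for p
  proof -
    obtain a b where p: "p = (a, b)" by (cases p)
    have "a \<noteq> b"
    proof
      assume "a = b"
      with that p have "\<bar>b\<bar> = 1" "0 \<le> - (\<eta> * (2 * \<bar>b\<bar> powr q))" by (auto simp: K_def F_def)
      with \<eta> show False by simp
    qed
    then show ?thesis unfolding p G_def by (simp add: powr_gap_pos q)
  qed
  have "\<exists>m>0. \<forall>p\<in>K. m \<le> G p"
  proof (cases "K = {}")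
    case True then show ?thesis by (auto intro: exI[of _ 1])
  next
    case False
    then obtain p where "p \<in> K" "\<forall>p'\<in>K. G p \<le> G p'"
      using continuous_attains_inf[OF compact _ contG] by blast
    then show ?thesis using pos by blast
  qed
  then obtain m where m: "0 < m" "\<And>p. p \<in> K \<Longrightarrow> m \<le> G p" by blast
  \<comment> \<open>The difference is at most \<open>2 powr q\<close> when \<open>max \<bar>a\<bar> \<bar>b\<bar> = 1\<close>, and the gap is at least \<open>m\<close>.\<close>
  define C where "C = 2 powr q / m"
  have C: "0 \<le> C" unfolding C_def using m by simp
  have "\<bar>a - b\<bar> powr q \<le> \<eta> * (\<bar>a\<bar> powr q + \<bar>b\<bar> powr q) + C * powr_gap q a b" for a b
  proof (cases "a = 0 \<and> b = 0")
    case True then show ?thesis by (simp add: powr_gap_def)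
  next
    case False
    define r where "r = max \<bar>a\<bar> \<bar>b\<bar>"
    have r: "0 < r" unfolding r_def using False by auto
    define a' b' where "a' = a / r" and "b' = b / r"
    have ab: "a = r * a'" "b = r * b'" using r by (auto simp: a'_def b'_def)
    have max1: "max \<bar>a'\<bar> \<bar>b'\<bar> = 1"
      using r by (auto simp: a'_def b'_def r_def max_def abs_divide)
    have scale: "\<bar>r * t\<bar> powr q = r powr q * \<bar>t\<bar> powr q" for t
      using r by (simp add: abs_mult powr_mult)
    have "F (a', b') \<le> C * G (a', b')"
    proof (cases "0 \<le> F (a', b')")
      case True
      then have "m \<le> G (a', b')" using max1 by (intro m(2)) (auto simp: K_def)
      then have "2 powr q \<le> C * G (a', b')"
        unfolding C_def using m(1) by (simp add: field_simps mult_left_mono)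
      moreover have "\<bar>a' - b'\<bar> powr q \<le> 2 powr q"
        using max1 q by (intro powr_mono2) auto
      moreover have "0 \<le> \<eta> * (\<bar>a'\<bar> powr q + \<bar>b'\<bar> powr q)" using \<eta> by simp
      ultimately show ?thesis unfolding F_def by simp
    next
      case False
      then show ?thesis using C powr_gap_nonneg[OF q]
        by (smt (verit) G_def case_prod_conv mult_nonneg_nonneg)
    qed
    then have "r powr q * F (a', b') \<le> r powr q * (C * G (a', b'))"
      by (intro mult_left_mono) auto
    moreover have "r powr q * F (a', b') = \<bar>a - b\<bar> powr q - \<eta> * (\<bar>a\<bar> powr q + \<bar>b\<bar> powr q)"
      unfolding F_def ab right_diff_distrib[symmetric, of r] scale
      by (simp add: algebra_simps)
    moreover have "r powr q * G (a', b') = powr_gap q a b"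
    proof -
      have "(r * a' + r * b') / 2 = r * ((a' + b') / 2)" by (simp add: algebra_simps)
      then show ?thesis unfolding G_def powr_gap_def ab scale
        by (simp only: case_prod_conv scale) (simp add: algebra_simps)
    qed
    ultimately show ?thesis by (simp add: algebra_simps)
  qed
  with C show ?thesis by blast
qed

lemma Lq_norm_nonneg: "0 \<le> Lq_norm \<mu> q u"
  by (simp add: Lq_norm_def)

lemma Lq_norm_powr:
  assumes "1 < q" shows "Lq_norm \<mu> q u powr q = (\<integral>x. \<bar>u x\<bar> powr q \<partial>\<mu>)"
  using assms by (simp add: Lq_norm_def powr_powr)

lemma Lq_norm_eq_0_iff:
  assumes "1 < q" "u \<in> Lq_space \<mu> q"
  shows "Lq_norm \<mu> q u = 0 \<longleftrightarrow> (AE x in \<mu>. u x = 0)"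
  using assms integral_nonneg_eq_0_iff_AE[of \<mu> "\<lambda>x. \<bar>u x\<bar> powr q"]
  by (simp add: Lq_norm_def Lq_space_def)

lemma Lq_norm_cong_AE:
  assumes "u \<in> borel_measurable \<mu>" "v \<in> borel_measurable \<mu>" "AE x in \<mu>. u x = v x"
  shows "Lq_norm \<mu> q u = Lq_norm \<mu> q v"
  unfolding Lq_norm_def using assms
  by (intro arg_cong2[of _ _ _ _ "(powr)"] integral_cong_AE) auto

lemma Lq_scale: "u \<in> Lq_space \<mu> q \<Longrightarrow> (\<lambda>x. c * u x) \<in> Lq_space \<mu> q"
  by (auto simp: Lq_space_def abs_mult powr_mult)

lemma Lq_norm_scale:
  assumes "1 < q" shows "Lq_norm \<mu> q (\<lambda>x. c * u x) = \<bar>c\<bar> * Lq_norm \<mu> q u"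
  using assms by (simp add: Lq_norm_def abs_mult powr_mult powr_powr)

lemma Lq_midpoint:
  assumes q: "1 < q" and u: "u \<in> Lq_space \<mu> q" and v: "v \<in> Lq_space \<mu> q"
  shows "(\<lambda>x. (u x + v x) / 2) \<in> Lq_space \<mu> q"
proof -
  have [measurable]: "u \<in> borel_measurable \<mu>" "v \<in> borel_measurable \<mu>"
    using u v by (auto simp: Lq_space_def)
  have int: "integrable \<mu> (\<lambda>x. (\<bar>u x\<bar> powr q + \<bar>v x\<bar> powr q) / 2)"
    using u v by (auto simp: Lq_space_def)
  have "integrable \<mu> (\<lambda>x. \<bar>(u x + v x) / 2\<bar> powr q)"
  proof (rule Bochner_Integration.integrable_bound[OF int _ AE_I2])
    fix x
    show "norm (\<bar>(u x + v x) / 2\<bar> powr q) \<le> norm ((\<bar>u x\<bar> powr q + \<bar>v x\<bar> powr q) / 2)"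
      using powr_gap_nonneg[OF q, of "u x" "v x"] unfolding powr_gap_def by simp
  qed measurable
  then show ?thesis by (simp add: Lq_space_def)
qed

lemma Lq_add:
  assumes "1 < q" and u: "u \<in> Lq_space \<mu> q" and v: "v \<in> Lq_space \<mu> q"
  shows "(\<lambda>x. u x + v x) \<in> Lq_space \<mu> q"
proof -
  have "(\<lambda>x. 2 * ((u x + v x) / 2)) = (\<lambda>x. u x + v x)"
    by (intro ext) (simp add: field_simps)
  then show ?thesis using Lq_scale[OF Lq_midpoint[OF assms], of 2] by metis
qed

lemma Lq_diff:
  assumes "1 < q" and u: "u \<in> Lq_space \<mu> q" and v: "v \<in> Lq_space \<mu> q"
  shows "(\<lambda>x. u x - v x) \<in> Lq_space \<mu> q"
  using Lq_add[OF assms(1) u Lq_scale[OF v, of "-1"]] by simp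

text \<open>
  Minkowski's inequality: convexity of \<open>t \<mapsto> t powr q\<close> is applied to \<open>\<bar>u\<bar> / \<parallel>u\<parallel>\<close> and \<open>\<bar>v\<bar> / \<parallel>v\<parallel>\<close> with
  weights proportional to the norms. The quotients require the case of norm \<open>0\<close> to be split off.
\<close>

lemma Lq_norm_triangle:
  assumes q: "1 < q" and u: "u \<in> Lq_space \<mu> q" and v: "v \<in> Lq_space \<mu> q"
  shows "Lq_norm \<mu> q (\<lambda>x. u x + v x) \<le> Lq_norm \<mu> q u + Lq_norm \<mu> q v"
proof -
  have [measurable]: "u \<in> borel_measurable \<mu>" "v \<in> borel_measurable \<mu>"
    using u v by (auto simp: Lq_space_def)
  define \<alpha> \<beta> where "\<alpha> = Lq_norm \<mu> q u" and "\<beta> = Lq_norm \<mu> q v"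
  have nn: "0 \<le> \<alpha>" "0 \<le> \<beta>" by (auto simp: \<alpha>_def \<beta>_def Lq_norm_nonneg)
  consider "\<alpha> = 0" | "\<beta> = 0" | "0 < \<alpha>" "0 < \<beta>" using nn by linarith
  then show ?thesis
  proof cases
    case 1
    then have "AE x in \<mu>. u x = 0" using Lq_norm_eq_0_iff[OF q u] by (simp add: \<alpha>_def)
    then have "Lq_norm \<mu> q (\<lambda>x. u x + v x) = Lq_norm \<mu> q v"
      by (intro Lq_norm_cong_AE) auto
    then show ?thesis using nn by (simp add: \<alpha>_def)
  next
    case 2
    then have "AE x in \<mu>. v x = 0" using Lq_norm_eq_0_iff[OF q v] by (simp add: \<beta>_def)
    then have "Lq_norm \<mu> q (\<lambda>x. u x + v x) = Lq_norm \<mu> q u"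
      by (intro Lq_norm_cong_AE) auto
    then show ?thesis using nn by (simp add: \<beta>_def)
  next
    case 3
    define \<theta> where "\<theta> = \<alpha> / (\<alpha> + \<beta>)"
    have \<theta>: "0 \<le> \<theta>" "\<theta> \<le> 1" and \<theta>': "1 - \<theta> = \<beta> / (\<alpha> + \<beta>)"
      using 3 by (auto simp: \<theta>_def field_simps)
    define k where "k = (\<alpha> + \<beta>) powr q"
    have bound: "\<bar>u x + v x\<bar> powr q
        \<le> k * (\<theta> * (\<bar>u x\<bar> powr q / \<alpha> powr q) + (1 - \<theta>) * (\<bar>v x\<bar> powr q / \<beta> powr q))" for x
    proof -
      have eq: "\<bar>u x\<bar> + \<bar>v x\<bar> = (\<alpha> + \<beta>) * (\<theta> * (\<bar>u x\<bar> / \<alpha>) + (1 - \<theta>) * (\<bar>v x\<bar> / \<beta>))"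
        unfolding \<theta>' unfolding \<theta>_def using 3 by (simp add: distrib_left)
      have "\<bar>u x + v x\<bar> powr q \<le> (\<bar>u x\<bar> + \<bar>v x\<bar>) powr q"
        using q by (intro powr_mono2) auto
      also have "\<dots> = k * (\<theta> * (\<bar>u x\<bar> / \<alpha>) + (1 - \<theta>) * (\<bar>v x\<bar> / \<beta>)) powr q"
        unfolding eq k_def using 3 \<theta> by (subst powr_mult) auto
      also have "\<dots> \<le> k * (\<theta> * (\<bar>u x\<bar> / \<alpha>) powr q + (1 - \<theta>) * (\<bar>v x\<bar> / \<beta>) powr q)"
        unfolding k_def using 3 \<theta> q by (intro mult_left_mono powr_convex_combination) auto
      finally show ?thesis using 3 by (simp add: powr_divide)
    qed
    have int: "integrable \<mu> (\<lambda>x. \<bar>u x\<bar> powr q)" "integrable \<mu> (\<lambda>x. \<bar>v x\<bar> powr q)"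
      using u v by (auto simp: Lq_space_def)
    have ab: "(\<integral>x. \<bar>u x\<bar> powr q \<partial>\<mu>) = \<alpha> powr q" "(\<integral>x. \<bar>v x\<bar> powr q \<partial>\<mu>) = \<beta> powr q"
      using q by (auto simp: \<alpha>_def \<beta>_def Lq_norm_powr)
    have "(\<integral>x. \<bar>u x + v x\<bar> powr q \<partial>\<mu>)
        \<le> (\<integral>x. k * (\<theta> * (\<bar>u x\<bar> powr q / \<alpha> powr q) + (1 - \<theta>) * (\<bar>v x\<bar> powr q / \<beta> powr q)) \<partial>\<mu>)"
      using Lq_add[OF q u v] int bound by (intro integral_mono) (auto simp: Lq_space_def)
    also have "\<dots> = k"
      using int 3 by (simp add: ab)
    finally have "Lq_norm \<mu> q (\<lambda>x. u x + v x) powr q \<le> (\<alpha> + \<beta>) powr q"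
      using q by (simp add: Lq_norm_powr k_def)
    then show ?thesis
      using q nn Lq_norm_nonneg[of \<mu> q "\<lambda>x. u x + v x"] unfolding \<alpha>_def[symmetric] \<beta>_def[symmetric]
      by (meson add_nonneg_nonneg less_trans not_le powr_less_mono2 zero_less_one)
  qed
qed

text \<open>
  Uniform convexity of \<open>L\<^sup>q\<close>, obtained by integrating \<open>powr_difference_le_gap\<close>. It applies to
  functions of arbitrary, possibly different norms, as needed when the norm is shared with the energy.
\<close>

lemma Lq_norm_diff_le_gap:
  fixes q \<eta> :: real
  assumes q: "1 < q" and \<eta>: "0 < \<eta>"
  shows "\<exists>C\<ge>0. \<forall>u\<in>Lq_space \<mu> q. \<forall>v\<in>Lq_space \<mu> q.
    Lq_norm \<mu> q (\<lambda>x. u x - v x) powr q \<le>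
      \<eta> * (Lq_norm \<mu> q u powr q + Lq_norm \<mu> q v powr q) +
      C * ((Lq_norm \<mu> q u powr q + Lq_norm \<mu> q v powr q) / 2
            - Lq_norm \<mu> q (\<lambda>x. (u x + v x) / 2) powr q)"
proof -
  obtain C where C: "0 \<le> C"
    "\<And>a b. \<bar>a - b\<bar> powr q \<le> \<eta> * (\<bar>a\<bar> powr q + \<bar>b\<bar> powr q) + C * powr_gap q a b"
    using powr_difference_le_gap[OF q \<eta>] by blast
  have "(\<integral>x. \<bar>u x - v x\<bar> powr q \<partial>\<mu>) \<le>
      \<eta> * ((\<integral>x. \<bar>u x\<bar> powr q \<partial>\<mu>) + (\<integral>x. \<bar>v x\<bar> powr q \<partial>\<mu>)) +
      C * (((\<integral>x. \<bar>u x\<bar> powr q \<partial>\<mu>) + (\<integral>x. \<bar>v x\<bar> powr q \<partial>\<mu>)) / 2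
            - (\<integral>x. \<bar>(u x + v x) / 2\<bar> powr q \<partial>\<mu>))"
    if u: "u \<in> Lq_space \<mu> q" and v: "v \<in> Lq_space \<mu> q" for u v
  proof -
    have int: "integrable \<mu> (\<lambda>x. \<bar>u x\<bar> powr q)" "integrable \<mu> (\<lambda>x. \<bar>v x\<bar> powr q)"
      "integrable \<mu> (\<lambda>x. \<bar>u x - v x\<bar> powr q)" "integrable \<mu> (\<lambda>x. \<bar>(u x + v x) / 2\<bar> powr q)"
      using u v Lq_diff[OF q u v] Lq_midpoint[OF q u v] by (auto simp: Lq_space_def)
    have "(\<integral>x. \<bar>u x - v x\<bar> powr q \<partial>\<mu>)
        \<le> (\<integral>x. \<eta> * (\<bar>u x\<bar> powr q + \<bar>v x\<bar> powr q) + C * powr_gap q (u x) (v x) \<partial>\<mu>)"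
      using int C(2) unfolding powr_gap_def by (intro integral_mono) auto
    then show ?thesis using int unfolding powr_gap_def by simp
  qed
  then show ?thesis using C(1) q by (auto simp: Lq_norm_powr)
qed

section \<open>Positive semidefinite forms on functions\<close>

text \<open>
  A positive semidefinite bilinear form on functions. Linearity is stated on \<open>V\<close> only, which is
  why the algebra below is spelled out instead of being inherited from inner product spaces.
\<close>

locale function_form =
  fixes V :: "('a \<Rightarrow> real) set"
    and B :: "('a \<Rightarrow> real) \<Rightarrow> ('a \<Rightarrow> real) \<Rightarrow> real"
  assumes linear: "linear_function_space V"
    and sym: "\<lbrakk>u \<in> V; v \<in> V\<rbrakk> \<Longrightarrow> B u v = B v u"
    and add: "\<lbrakk>u \<in> V; v \<in> V; w \<in> V\<rbrakk> \<Longrightarrow> B (\<lambda>x. u x + v x) w = B u w + B v w"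
    and scale: "\<lbrakk>u \<in> V; v \<in> V\<rbrakk> \<Longrightarrow> B (\<lambda>x. c * u x) v = c * B u v"
    and nonneg: "u \<in> V \<Longrightarrow> 0 \<le> B u u"
begin

definition seminorm :: "('a \<Rightarrow> real) \<Rightarrow> real" where
  "seminorm u = sqrt (B u u)"

lemma zero_mem: "(\<lambda>x. 0) \<in> V"
  and add_mem: "\<lbrakk>u \<in> V; v \<in> V\<rbrakk> \<Longrightarrow> (\<lambda>x. u x + v x) \<in> V"
  and scale_mem: "u \<in> V \<Longrightarrow> (\<lambda>x. c * u x) \<in> V"
  using linear by (auto simp: linear_function_space_def)

lemma diff_mem: "\<lbrakk>u \<in> V; v \<in> V\<rbrakk> \<Longrightarrow> (\<lambda>x. u x - v x) \<in> V"
  using add_mem[of u "\<lambda>x. (-1) * v x"] scale_mem[of v "-1"] by simp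

lemma half_mem: "\<lbrakk>u \<in> V; v \<in> V\<rbrakk> \<Longrightarrow> (\<lambda>x. (u x + v x) / 2) \<in> V"
  using scale_mem[OF add_mem[of u v], of "1/2"] by simp

lemma add_right: "\<lbrakk>u \<in> V; v \<in> V; w \<in> V\<rbrakk> \<Longrightarrow> B w (\<lambda>x. u x + v x) = B w u + B w v"
  by (simp add: sym[of w] add add_mem)

lemma scale_right: "\<lbrakk>u \<in> V; v \<in> V\<rbrakk> \<Longrightarrow> B v (\<lambda>x. c * u x) = c * B v u"
  by (simp add: sym[of v] scale scale_mem)

lemma diff: "\<lbrakk>u \<in> V; v \<in> V; w \<in> V\<rbrakk> \<Longrightarrow> B (\<lambda>x. u x - v x) w = B u w - B v w"
  using add[of u "\<lambda>x. (-1) * v x" w] scale_mem[of v "-1"] scale[of v w "-1"] by simp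

lemma diff_right: "\<lbrakk>u \<in> V; v \<in> V; w \<in> V\<rbrakk> \<Longrightarrow> B w (\<lambda>x. u x - v x) = B w u - B w v"
  by (simp add: sym[of w] diff diff_mem)

lemma zero_right: "u \<in> V \<Longrightarrow> B u (\<lambda>x. 0) = 0"
  using scale_right[of u u 0] by simp

lemma half: "\<lbrakk>u \<in> V; v \<in> V; w \<in> V\<rbrakk> \<Longrightarrow> B (\<lambda>x. (u x + v x) / 2) w = (B u w + B v w) / 2"
  using scale[OF add_mem[of u v], of w "1/2"] add[of u v w] by simp

lemma half_right: "\<lbrakk>u \<in> V; v \<in> V; w \<in> V\<rbrakk> \<Longrightarrow> B w (\<lambda>x. (u x + v x) / 2) = (B w u + B w v) / 2"
  by (simp add: sym[of w] half half_mem)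

lemma quadratic_add: "\<lbrakk>u \<in> V; v \<in> V\<rbrakk> \<Longrightarrow>
    B (\<lambda>x. u x + v x) (\<lambda>x. u x + v x) = B u u + 2 * B u v + B v v"
  by (simp add: add add_right add_mem sym[of v u])

lemma quadratic_diff: "\<lbrakk>u \<in> V; v \<in> V\<rbrakk> \<Longrightarrow>
    B (\<lambda>x. u x - v x) (\<lambda>x. u x - v x) = B u u - 2 * B u v + B v v"
  by (simp add: diff diff_right diff_mem sym[of v u])

lemma quadratic_half: "\<lbrakk>u \<in> V; v \<in> V\<rbrakk> \<Longrightarrow>
    B (\<lambda>x. (u x + v x) / 2) (\<lambda>x. (u x + v x) / 2)
      = (B u u + B v v) / 2 - B (\<lambda>x. u x - v x) (\<lambda>x. u x - v x) / 4"
  by (simp add: half half_right half_mem quadratic_diff sym[of v u] field_simps)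

lemma quadratic_scale: "u \<in> V \<Longrightarrow> B (\<lambda>x. c * u x) (\<lambda>x. c * u x) = c\<^sup>2 * B u u"
  by (simp add: scale scale_right scale_mem power2_eq_square)

lemma quadratic_diff_commute: "\<lbrakk>u \<in> V; v \<in> V\<rbrakk> \<Longrightarrow>
    B (\<lambda>x. u x - v x) (\<lambda>x. u x - v x) = B (\<lambda>x. v x - u x) (\<lambda>x. v x - u x)"
  by (simp add: quadratic_diff sym[of v u])

lemma seminorm_nonneg: "u \<in> V \<Longrightarrow> 0 \<le> seminorm u"
  by (simp add: seminorm_def nonneg)

lemma seminorm_power2: "u \<in> V \<Longrightarrow> (seminorm u)\<^sup>2 = B u u"
  by (simp add: seminorm_def nonneg)

lemma cauchy_schwarz:
  assumes "u \<in> V" "v \<in> V" shows "\<bar>B u v\<bar> \<le> seminorm u * seminorm v"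
proof -
  have "0 \<le> B u u + 2 * t * B u v + t\<^sup>2 * B v v" for t
    using nonneg[OF add_mem[OF assms(1) scale_mem[OF assms(2), of t]]] assms
    by (simp add: quadratic_add scale_mem quadratic_scale scale_right algebra_simps)
  then have *: "0 \<le> B u u + 2 * t * B u v + t\<^sup>2 * B v v" for t .
  have "(B u v)\<^sup>2 \<le> B u u * B v v"
  proof (cases "B v v = 0")
    case True
    have "B u v = 0"
    proof (rule ccontr)
      assume "B u v \<noteq> 0"
      with *[of "- (B u u + 1) / (2 * B u v)"] True show False by (simp add: field_simps)
    qed
    then show ?thesis using True by simp
  next
    case False
    then have pos: "0 < B v v" using nonneg[OF assms(2)] by simp
    have "0 \<le> B v v * (B u u + 2 * (- B u v / B v v) * B u v + (- B u v / B v v)\<^sup>2 * B v v)"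
      using pos by (intro mult_nonneg_nonneg *) simp
    also have "\<dots> = B u u * B v v - (B u v)\<^sup>2"
      using pos by (simp add: field_simps power2_eq_square)
    finally show ?thesis by simp
  qed
  then have "sqrt ((B u v)\<^sup>2) \<le> sqrt (B u u * B v v)" by (rule real_sqrt_le_mono)
  then show ?thesis by (simp add: seminorm_def real_sqrt_mult)
qed

lemma seminorm_add:
  assumes "u \<in> V" "v \<in> V"
  shows "seminorm (\<lambda>x. u x + v x) \<le> seminorm u + seminorm v"
proof (rule power2_le_imp_le)
  show "(seminorm (\<lambda>x. u x + v x))\<^sup>2 \<le> (seminorm u + seminorm v)\<^sup>2"
    using assms cauchy_schwarz[OF assms]
    by (simp add: seminorm_power2 add_mem quadratic_add power2_sum)
qed (use assms seminorm_nonneg in simp)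

lemma seminorm_scale: "u \<in> V \<Longrightarrow> seminorm (\<lambda>x. c * u x) = \<bar>c\<bar> * seminorm u"
  by (simp add: seminorm_def quadratic_scale real_sqrt_mult)

lemma seminorm_diff_commute: "\<lbrakk>u \<in> V; v \<in> V\<rbrakk> \<Longrightarrow>
    seminorm (\<lambda>x. u x - v x) = seminorm (\<lambda>x. v x - u x)"
  using quadratic_diff_commute[of u v] by (simp add: seminorm_def)

lemma seminorm_diff:
  assumes "u \<in> V" "v \<in> V"
  shows "seminorm (\<lambda>x. u x - v x) \<le> seminorm u + seminorm v"
  using seminorm_add[OF assms(1) scale_mem[OF assms(2), of "-1"]] seminorm_scale[OF assms(2), of "-1"]
  by simp

lemma seminorm_reverse_triangle:
  assumes "u \<in> V" "v \<in> V"
  shows "\<bar>seminorm u - seminorm v\<bar> \<le> seminorm (\<lambda>x. u x - v x)"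
  using seminorm_add[OF diff_mem[OF assms] assms(2)]
    seminorm_add[OF diff_mem[OF assms(2,1)] assms(1)] seminorm_diff_commute[OF assms] by simp

lemma form_cauchy_iff_seminorm:
  assumes "\<And>k. U k \<in> V"
  shows "form_cauchy B U \<longleftrightarrow>
    (\<forall>e>0. \<exists>n. \<forall>k\<ge>n. \<forall>l\<ge>n. seminorm (\<lambda>x. U k x - U l x) < e)"
proof
  assume C: "form_cauchy B U"
  show "\<forall>e>0. \<exists>n. \<forall>k\<ge>n. \<forall>l\<ge>n. seminorm (\<lambda>x. U k x - U l x) < e"
  proof (intro allI impI)
    fix e :: real assume e: "0 < e"
    then have "0 < e\<^sup>2" by simp
    then obtain n where n: "\<forall>k\<ge>n. \<forall>l\<ge>n. B (\<lambda>x. U k x - U l x) (\<lambda>x. U k x - U l x) < e\<^sup>2"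
      using C unfolding form_cauchy_def by meson
    have "seminorm (\<lambda>x. U k x - U l x) < e" if "n \<le> k" "n \<le> l" for k l
      using n that e unfolding seminorm_def by (intro real_less_lsqrt) auto
    then show "\<exists>n. \<forall>k\<ge>n. \<forall>l\<ge>n. seminorm (\<lambda>x. U k x - U l x) < e" by blast
  qed
next
  assume C: "\<forall>e>0. \<exists>n. \<forall>k\<ge>n. \<forall>l\<ge>n. seminorm (\<lambda>x. U k x - U l x) < e"
  show "form_cauchy B U" unfolding form_cauchy_def
  proof (intro allI impI)
    fix e :: real assume e: "0 < e"
    then have "0 < sqrt e" by simp
    then obtain n where "\<forall>k\<ge>n. \<forall>l\<ge>n. seminorm (\<lambda>x. U k x - U l x) < sqrt e"
      using C by meson
    then show "\<exists>n. \<forall>k\<ge>n. \<forall>l\<ge>n. B (\<lambda>x. U k x - U l x) (\<lambda>x. U k x - U l x) < e"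
      unfolding seminorm_def by auto
  qed
qed

lemma cauchy_seminormD:
  assumes "form_cauchy B U" "\<And>k. U k \<in> V" "0 < e"
  obtains n where "\<And>k l. \<lbrakk>n \<le> k; n \<le> l\<rbrakk> \<Longrightarrow> seminorm (\<lambda>x. U k x - U l x) < e"
proof -
  have "\<forall>e>0. \<exists>n. \<forall>k\<ge>n. \<forall>l\<ge>n. seminorm (\<lambda>x. U k x - U l x) < e"
    using assms(1) unfolding form_cauchy_iff_seminorm[of U, OF assms(2)] .
  then obtain n where n: "\<forall>k\<ge>n. \<forall>l\<ge>n. seminorm (\<lambda>x. U k x - U l x) < e"
    using assms(3) by auto
  show thesis by (rule that[of n]) (use n in blast)
qed

lemma cauchy_seminorm_convergent:
  assumes "\<And>k. U k \<in> V" "form_cauchy B U"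
  shows "convergent (\<lambda>k. seminorm (U k))"
proof (rule Cauchy_convergent, rule metric_CauchyI)
  fix e :: real assume "0 < e"
  then obtain n where "\<forall>k\<ge>n. \<forall>l\<ge>n. seminorm (\<lambda>x. U k x - U l x) < e"
    using assms form_cauchy_iff_seminorm by meson
  then show "\<exists>M. \<forall>m\<ge>M. \<forall>n\<ge>M. dist (seminorm (U m)) (seminorm (U n)) < e"
    using seminorm_reverse_triangle[OF assms(1) assms(1)] unfolding dist_real_def
    by (meson order_le_less_trans)
qed

lemma cauchy_seminorm_bounded:
  assumes "\<And>k. U k \<in> V" "form_cauchy B U"
  obtains R where "0 < R" "\<And>k. seminorm (U k) \<le> R"
proof -
  have "Bseq (\<lambda>k. seminorm (U k))"
    using cauchy_seminorm_convergent[OF assms] by (rule convergent_imp_Bseq)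
  then show thesis
    using that by (metis BseqE abs_le_D1 real_norm_def)
qed

lemma cauchy_add:
  assumes "\<And>k. U k \<in> V" "form_cauchy B U" "\<And>k. W k \<in> V" "form_cauchy B W"
  shows "form_cauchy B (\<lambda>k x. U k x + W k x)"
proof -
  have "\<exists>n. \<forall>k\<ge>n. \<forall>l\<ge>n. seminorm (\<lambda>x. (U k x + W k x) - (U l x + W l x)) < e" if "0 < e" for e
  proof -
    obtain n1 where n1: "\<forall>k\<ge>n1. \<forall>l\<ge>n1. seminorm (\<lambda>x. U k x - U l x) < e / 2"
      using assms(1,2) form_cauchy_iff_seminorm \<open>0 < e\<close> by (meson half_gt_zero)
    obtain n2 where n2: "\<forall>k\<ge>n2. \<forall>l\<ge>n2. seminorm (\<lambda>x. W k x - W l x) < e / 2"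
      using assms(3,4) form_cauchy_iff_seminorm \<open>0 < e\<close> by (meson half_gt_zero)
    have "seminorm (\<lambda>x. (U k x + W k x) - (U l x + W l x)) < e"
      if "max n1 n2 \<le> k" "max n1 n2 \<le> l" for k l
    proof -
      have "(\<lambda>x. (U k x + W k x) - (U l x + W l x)) = (\<lambda>x. (U k x - U l x) + (W k x - W l x))"
        by auto
      moreover have "seminorm (\<lambda>x. (U k x - U l x) + (W k x - W l x))
          \<le> seminorm (\<lambda>x. U k x - U l x) + seminorm (\<lambda>x. W k x - W l x)"
        by (intro seminorm_add diff_mem assms)
      moreover have "seminorm (\<lambda>x. U k x - U l x) < e / 2" "seminorm (\<lambda>x. W k x - W l x) < e / 2"
        using n1 n2 that by auto
      ultimately show ?thesis by simp
    qed
    then show ?thesis by blast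
  qed
  then show ?thesis
    using form_cauchy_iff_seminorm[of "\<lambda>k x. U k x + W k x"] add_mem assms(1,3) by blast
qed

lemma cauchy_scale:
  assumes "\<And>k. U k \<in> V" "form_cauchy B U"
  shows "form_cauchy B (\<lambda>k x. c * U k x)"
proof -
  have "\<exists>n. \<forall>k\<ge>n. \<forall>l\<ge>n. seminorm (\<lambda>x. c * U k x - c * U l x) < e" if "0 < e" for e
  proof -
    have "0 < e / (\<bar>c\<bar> + 1)" using that by simp
    then obtain n where n: "\<forall>k\<ge>n. \<forall>l\<ge>n. seminorm (\<lambda>x. U k x - U l x) < e / (\<bar>c\<bar> + 1)"
      using assms form_cauchy_iff_seminorm by meson
    have "seminorm (\<lambda>x. c * U k x - c * U l x) < e" if "n \<le> k" "n \<le> l" for k l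
    proof -
      have "seminorm (\<lambda>x. c * (U k x - U l x)) = \<bar>c\<bar> * seminorm (\<lambda>x. U k x - U l x)"
        by (intro seminorm_scale diff_mem assms)
      moreover have "\<dots> \<le> (\<bar>c\<bar> + 1) * seminorm (\<lambda>x. U k x - U l x)"
        using seminorm_nonneg[OF diff_mem[OF assms(1) assms(1), of k l]]
        by (intro mult_right_mono) auto
      moreover have "\<dots> < e"
      proof -
        have "seminorm (\<lambda>x. U k x - U l x) < e / (\<bar>c\<bar> + 1)" using n that by auto
        moreover have "0 < \<bar>c\<bar> + 1" by simp
        ultimately show ?thesis by (metis mult.commute pos_less_divide_eq)
      qed
      ultimately show ?thesis by (simp add: right_diff_distrib)
    qed
    then show ?thesis by blast
  qed
  then show ?thesis
    using form_cauchy_iff_seminorm[of "\<lambda>k x. c * U k x"] scale_mem assms(1) by blast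
qed

end


text \<open>
  The projection argument of Hilbert space theory, for decreasing sets in place of one fixed
  convex set. In the applications \<open>Q\<close> is an energy and \<open>D\<close> a quarter of the energy of the difference,
  so that the midpoint condition is the parallelogram identity. The infima of \<open>Q\<close> over \<open>C n\<close>
  increase and are bounded by \<open>R\<close>; hence for late indices two almost minimizers have a midpoint
  that is hardly better, which makes their difference small.
\<close>

lemma minimizing_sequence:
  fixes C :: "nat \<Rightarrow> 'b set" and Q :: "'b \<Rightarrow> real" and D :: "'b \<Rightarrow> 'b \<Rightarrow> real"
  assumes nonempty: "\<And>n. \<exists>y\<in>C n. Q y \<le> R"
    and decreasing: "\<And>m n. m \<le> n \<Longrightarrow> C n \<subseteq> C m"
    and nonneg: "\<And>n y. y \<in> C n \<Longrightarrow> 0 \<le> Q y"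
    and midpoint: "\<And>n y z. \<lbrakk>y \<in> C n; z \<in> C n\<rbrakk> \<Longrightarrow> \<exists>m\<in>C n. Q m \<le> (Q y + Q z) / 2 - D y z"
  shows "\<exists>Y. (\<forall>n. Y n \<in> C n) \<and> (\<forall>e>0. \<exists>n. \<forall>k\<ge>n. \<forall>l\<ge>n. D (Y k) (Y l) < e)"
proof -
  define d where "d n = Inf (Q ` C n)" for n
  have bdd: "bdd_below (Q ` C n)" for n using nonneg by (auto intro!: bdd_belowI[of _ 0])
  have ne: "Q ` C n \<noteq> {}" for n using nonempty by fast
  have low: "d n \<le> Q y" if "y \<in> C n" for n y
    unfolding d_def using that bdd by (intro cInf_lower) auto
  have "\<exists>y\<in>C n. Q y < d n + 1 / (real n + 1)" for n
  proof -
    have "Inf (Q ` C n) < d n + 1 / (real n + 1)" unfolding d_def by simp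
    from cInf_lessD[OF ne this] show ?thesis by auto
  qed
  then obtain Y where Y: "\<And>n. Y n \<in> C n" "\<And>n. Q (Y n) < d n + 1 / (real n + 1)"
    by metis
  have inc: "d m \<le> d n" if "m \<le> n" for m n
    unfolding d_def using decreasing[OF that] ne bdd by (intro cInf_superset_mono) auto
  have "d n \<le> R" for n using nonempty[of n] low[of _ n] by force
  then have "Bseq d"
  proof (intro BseqI'[of _ "\<bar>R\<bar> + \<bar>d 0\<bar>"])
    fix n
    have "d 0 \<le> d n" "d n \<le> R" using inc[of 0 n] \<open>\<And>n. d n \<le> R\<close> by auto
    then show "norm (d n) \<le> \<bar>R\<bar> + \<bar>d 0\<bar>" unfolding real_norm_def by linarith
  qed
  then have "Cauchy d"
    using inc by (intro convergent_Cauchy Bseq_mono_convergent) auto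
  have "\<exists>n. \<forall>k\<ge>n. \<forall>l\<ge>n. D (Y k) (Y l) < e" if e: "0 < e" for e
  proof -
    obtain n1 where n1: "\<forall>k\<ge>n1. \<forall>l\<ge>n1. dist (d k) (d l) < e / 2"
      using \<open>Cauchy d\<close> e by (meson half_gt_zero metric_CauchyD)
    obtain n2 :: nat where n2: "1 / (real n2 + 1) < e / 2"
      using e by (metis half_gt_zero nat_approx_posE of_nat_Suc add.commute)
    have main: "D (Y k) (Y l) < e" if k: "max n1 n2 \<le> k" and l: "max n1 n2 \<le> l" for k l
    proof -
      define j where "j = max n1 n2"
      have "Y k \<in> C j" "Y l \<in> C j" using k l Y(1) decreasing unfolding j_def by blast+
      then obtain m where m: "m \<in> C j" "Q m \<le> (Q (Y k) + Q (Y l)) / 2 - D (Y k) (Y l)"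
        using midpoint by blast
      have small: "Q (Y i) < d j + e" if "j \<le> i" for i
      proof -
        have "1 / (real i + 1) \<le> 1 / (real n2 + 1)"
          using that unfolding j_def by (intro divide_left_mono) auto
        moreover have "dist (d i) (d j) < e / 2"
          using n1 that unfolding j_def by auto
        then have "d i < d j + e / 2" unfolding dist_real_def by linarith
        ultimately show ?thesis using Y(2)[of i] n2 by simp
      qed
      have "Q (Y k) < d j + e" "Q (Y l) < d j + e" using k l unfolding j_def[symmetric] by (auto intro: small)
      with low[OF m(1)] m(2) show ?thesis by argo
    qed
    then show ?thesis by blast
  qed
  with Y(1) show ?thesis by blast
qed

section \<open>Closedness and lattice properties of Dirichlet forms\<close>

lemma Lq_space_2_iff:
  "u \<in> Lq_space \<mu> 2 \<longleftrightarrow> u \<in> borel_measurable \<mu> \<and> integrable \<mu> (\<lambda>x. (u x)\<^sup>2)"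
  by (simp add: Lq_space_def)

lemma integral_square_diff_le:
  fixes u v w :: "'a \<Rightarrow> real"
  assumes [measurable]: "u \<in> borel_measurable \<mu>" "w \<in> borel_measurable \<mu>"
    and int: "integrable \<mu> (\<lambda>x. (u x - v x)\<^sup>2)" "integrable \<mu> (\<lambda>x. (v x - w x)\<^sup>2)"
  shows "integrable \<mu> (\<lambda>x. (u x - w x)\<^sup>2)" (is ?I)
    and "(\<integral>x. (u x - w x)\<^sup>2 \<partial>\<mu>) \<le> 2 * (\<integral>x. (u x - v x)\<^sup>2 \<partial>\<mu>) + 2 * (\<integral>x. (v x - w x)\<^sup>2 \<partial>\<mu>)"
proof -
  have bound: "(u x - w x)\<^sup>2 \<le> 2 * (u x - v x)\<^sup>2 + 2 * (v x - w x)\<^sup>2" for x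
    using zero_le_power2[of "(u x - v x) - (v x - w x)"]
    by (simp add: power2_eq_square algebra_simps)
  have int2: "integrable \<mu> (\<lambda>x. 2 * (u x - v x)\<^sup>2 + 2 * (v x - w x)\<^sup>2)" using int by simp
  show ?I
    by (rule Bochner_Integration.integrable_bound[OF int2]) (use bound in auto)
  then have "(\<integral>x. (u x - w x)\<^sup>2 \<partial>\<mu>) \<le> (\<integral>x. 2 * (u x - v x)\<^sup>2 + 2 * (v x - w x)\<^sup>2 \<partial>\<mu>)"
    using int2 bound by (rule integral_mono)
  then show "(\<integral>x. (u x - w x)\<^sup>2 \<partial>\<mu>)
      \<le> 2 * (\<integral>x. (u x - v x)\<^sup>2 \<partial>\<mu>) + 2 * (\<integral>x. (v x - w x)\<^sup>2 \<partial>\<mu>)"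
    using int by simp
qed

lemma integral_square_tendsto_0:
  fixes V :: "nat \<Rightarrow> 'a \<Rightarrow> real"
  assumes meas: "\<And>n. V n \<in> borel_measurable \<mu>" and g: "g \<in> Lq_space \<mu> 2"
    and lim: "AE x in \<mu>. (\<lambda>n. V n x) \<longlonglongrightarrow> 0" and dom: "\<And>n x. \<bar>V n x\<bar> \<le> \<bar>g x\<bar>"
  shows "\<And>n. integrable \<mu> (\<lambda>x. (V n x)\<^sup>2)"
    and "(\<lambda>n. \<integral>x. (V n x)\<^sup>2 \<partial>\<mu>) \<longlonglongrightarrow> 0"
proof -
  note [measurable] = meas
  have intg: "integrable \<mu> (\<lambda>x. (g x)\<^sup>2)" using g by (simp add: Lq_space_2_iff)
  have le: "(V n x)\<^sup>2 \<le> (g x)\<^sup>2" for n x using dom by (rule abs_le_square_iff[THEN iffD1])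
  show "integrable \<mu> (\<lambda>x. (V n x)\<^sup>2)" for n
    by (rule Bochner_Integration.integrable_bound[OF intg]) (use le in auto)
  have "(\<lambda>n. \<integral>x. (V n x)\<^sup>2 \<partial>\<mu>) \<longlonglongrightarrow> (\<integral>x. 0 \<partial>\<mu>)"
  proof (rule integral_dominated_convergence[OF _ _ intg])
    show "AE x in \<mu>. (\<lambda>n. (V n x)\<^sup>2) \<longlonglongrightarrow> 0"
      using lim by eventually_elim (auto intro: tendsto_eq_intros)
  qed (use le in auto)
  then show "(\<lambda>n. \<integral>x. (V n x)\<^sup>2 \<partial>\<mu>) \<longlonglongrightarrow> 0" by simp
qed

sublocale dirichlet_form \<subseteq> form: function_form \<F> \<E>
  by unfold_locales (fact domain_linear form_sym form_add form_scale form_nonneg)+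

context dirichlet_form
begin

abbreviation seminorm where "seminorm \<equiv> form.seminorm"

lemma domain_measurable: "u \<in> \<F> \<Longrightarrow> u \<in> borel_measurable \<mu>"
  using domain_L2 by (auto simp: Lq_space_def)

lemma domain_square_integrable: "u \<in> \<F> \<Longrightarrow> integrable \<mu> (\<lambda>x. (u x)\<^sup>2)"
  using domain_L2 by (auto simp: Lq_space_2_iff)

lemma quadratic_form_ae:
  assumes "u \<in> \<F>" "v \<in> \<F>" "AE x in \<mu>. u x = v x"
  shows "\<E> u u = \<E> v v"
  using form_ae[OF assms(1,2,1,3)] form_ae[OF assms(1,2,2,3)] form_sym[OF assms(1,2)] by simp

text \<open>
  The form is closed in \<open>L\<^sup>2\<close>: bounds on the energy, and on the form against a fixed \<open>f\<close>, survive
  \<open>L\<^sup>2\<close>-limits, and finite energy puts the limit into the domain. The admissible approximants form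
  decreasing convex sets; a minimizing sequence of the energy in them is Cauchy for the
  complete inner product, and its limit there agrees with \<open>v\<close> almost everywhere.
\<close>

lemma L2_closed:
  assumes v: "v \<in> borel_measurable \<mu>" and f: "f \<in> \<F>"
    and approx: "\<And>n. \<exists>y\<in>\<F>. \<E> y y \<le> R \<and> c \<le> \<E> y f \<and>
      integrable \<mu> (\<lambda>x. (y x - v x)\<^sup>2) \<and> (\<integral>x. (y x - v x)\<^sup>2 \<partial>\<mu>) \<le> 1 / (real n + 1)"
  shows "v \<in> \<F>" "\<E> v v \<le> R" "c \<le> \<E> v f"
proof -
  define C where "C n = {y \<in> \<F>. \<E> y y \<le> R \<and> c \<le> \<E> y f \<and>
    integrable \<mu> (\<lambda>x. (y x - v x)\<^sup>2) \<and> (\<integral>x. (y x - v x)\<^sup>2 \<partial>\<mu>) \<le> 1 / (real n + 1)}" for n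
  have "\<exists>Y. (\<forall>n. Y n \<in> C n) \<and>
    (\<forall>e>0. \<exists>n. \<forall>k\<ge>n. \<forall>l\<ge>n. \<E> (\<lambda>x. Y k x - Y l x) (\<lambda>x. Y k x - Y l x) / 4 < e)"
  proof (rule minimizing_sequence[where Q = "\<lambda>y. \<E> y y" and R = R])
    show "\<exists>y\<in>C n. \<E> y y \<le> R" for n using approx[of n] by (auto simp: C_def)
    show "C n \<subseteq> C m" if "m \<le> n" for m n
    proof -
      have "1 / (real n + 1) \<le> 1 / (real m + 1)" using that by (intro divide_left_mono) auto
      then show ?thesis by (auto simp: C_def)
    qed
    show "0 \<le> \<E> y y" if "y \<in> C n" for n y using that form_nonneg by (auto simp: C_def)
    show "\<exists>m\<in>C n. \<E> m m \<le> (\<E> y y + \<E> z z) / 2 - \<E> (\<lambda>x. y x - z x) (\<lambda>x. y x - z x) / 4"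
      if y: "y \<in> C n" and z: "z \<in> C n" for n y z
    proof -
      define m where "m = (\<lambda>x. (y x + z x) / 2)"
      have yz: "y \<in> \<F>" "z \<in> \<F>" using y z by (auto simp: C_def)
      have [measurable]: "y \<in> borel_measurable \<mu>" "z \<in> borel_measurable \<mu>" "v \<in> borel_measurable \<mu>"
        using yz v by (auto intro: domain_measurable)
      have m: "m \<in> \<F>" unfolding m_def using yz by (rule form.half_mem)
      have energy: "\<E> m m = (\<E> y y + \<E> z z) / 2 - \<E> (\<lambda>x. y x - z x) (\<lambda>x. y x - z x) / 4"
        unfolding m_def using yz by (rule form.quadratic_half)
      have "0 \<le> \<E> (\<lambda>x. y x - z x) (\<lambda>x. y x - z x)"
        using yz by (intro form_nonneg form.diff_mem)
      moreover have "\<E> y y \<le> R" "\<E> z z \<le> R" using y z by (auto simp: C_def)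
      ultimately have "\<E> m m \<le> R" unfolding energy by argo
      moreover have "c \<le> \<E> m f"
        unfolding m_def using y z f by (auto simp: form.half C_def)
      moreover have bound: "(m x - v x)\<^sup>2 \<le> ((y x - v x)\<^sup>2 + (z x - v x)\<^sup>2) / 2" for x
        using zero_le_power2[of "y x - z x"]
        unfolding m_def by (simp add: power2_eq_square field_simps)
      have int: "integrable \<mu> (\<lambda>x. ((y x - v x)\<^sup>2 + (z x - v x)\<^sup>2) / 2)"
        using y z by (auto simp: C_def)
      have intm: "integrable \<mu> (\<lambda>x. (m x - v x)\<^sup>2)"
        by (rule Bochner_Integration.integrable_bound[OF int]) (use bound in \<open>auto simp: m_def\<close>)
      moreover have "(\<integral>x. (m x - v x)\<^sup>2 \<partial>\<mu>) \<le> (\<integral>x. ((y x - v x)\<^sup>2 + (z x - v x)\<^sup>2) / 2 \<partial>\<mu>)"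
        using intm int bound by (rule integral_mono)
      then have "(\<integral>x. (m x - v x)\<^sup>2 \<partial>\<mu>) \<le> 1 / (real n + 1)"
        using y z by (auto simp: C_def)
      ultimately have "m \<in> C n" using m by (auto simp: C_def)
      then show ?thesis using energy by (intro bexI[of _ m]) simp_all
    qed
  qed
  then obtain Y where Y: "\<And>n. Y n \<in> C n"
    and cauchy: "\<And>e. 0 < e \<Longrightarrow>
      \<exists>n. \<forall>k\<ge>n. \<forall>l\<ge>n. \<E> (\<lambda>x. Y k x - Y l x) (\<lambda>x. Y k x - Y l x) / 4 < e" by blast
  have YF: "Y n \<in> \<F>" and YR: "\<E> (Y n) (Y n) \<le> R" and Yc: "c \<le> \<E> (Y n) f"
    and Yint: "integrable \<mu> (\<lambda>x. (Y n x - v x)\<^sup>2)"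
    and Yle: "(\<integral>x. (Y n x - v x)\<^sup>2 \<partial>\<mu>) \<le> 1 / (real n + 1)" for n
    using Y[of n] by (auto simp: C_def)
  note [measurable] = domain_measurable[OF YF] v
  have Yint': "integrable \<mu> (\<lambda>x. (v x - Y n x)\<^sup>2)"
    and Yle': "(\<integral>x. (v x - Y n x)\<^sup>2 \<partial>\<mu>) \<le> 1 / (real n + 1)" for n
    using Yint[of n] Yle[of n] by (auto simp: power2_commute)
  have "form_cauchy (energy_inner \<mu> \<E>) Y" unfolding form_cauchy_def
  proof (intro allI impI)
    fix e :: real assume e: "0 < e"
    obtain n1 where n1: "\<forall>k\<ge>n1. \<forall>l\<ge>n1. \<E> (\<lambda>x. Y k x - Y l x) (\<lambda>x. Y k x - Y l x) / 4 < e / 8"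
      using cauchy[of "e / 8"] e by auto
    obtain n2 :: nat where n2: "1 / (real n2 + 1) < e / 8"
      using e by (metis add.commute nat_approx_posE of_nat_Suc zero_less_divide_iff zero_less_numeral)
    have "energy_inner \<mu> \<E> (\<lambda>x. Y k x - Y l x) (\<lambda>x. Y k x - Y l x) < e"
      if "max n1 n2 \<le> k" "max n1 n2 \<le> l" for k l
    proof -
      have "(\<integral>x. (Y k x - Y l x)\<^sup>2 \<partial>\<mu>) \<le> 2 * (1 / (real k + 1)) + 2 * (1 / (real l + 1))"
        using integral_square_diff_le(2)[of "Y k" \<mu> "Y l" v] Yint Yint' Yle[of k] Yle'[of l] by simp
      moreover have "1 / (real k + 1) \<le> 1 / (real n2 + 1)" "1 / (real l + 1) \<le> 1 / (real n2 + 1)"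
        using that by (auto intro!: divide_left_mono)
      moreover have "\<E> (\<lambda>x. Y k x - Y l x) (\<lambda>x. Y k x - Y l x) / 4 < e / 8"
        using n1 that by auto
      ultimately show ?thesis
        using n2 unfolding energy_inner_def power2_eq_square[symmetric] by simp
    qed
    then show "\<exists>n. \<forall>k\<ge>n. \<forall>l\<ge>n.
        energy_inner \<mu> \<E> (\<lambda>x. Y k x - Y l x) (\<lambda>x. Y k x - Y l x) < e" by blast
  qed
  then obtain w where w: "w \<in> \<F>"
    and "(\<lambda>k. energy_inner \<mu> \<E> (\<lambda>x. Y k x - w x) (\<lambda>x. Y k x - w x)) \<longlonglongrightarrow> 0"
    using form_complete[of Y, OF YF] by blast
  then have lim: "(\<lambda>k. (\<integral>x. (Y k x - w x)\<^sup>2 \<partial>\<mu>) + \<E> (\<lambda>x. Y k x - w x) (\<lambda>x. Y k x - w x)) \<longlonglongrightarrow> 0"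
    by (simp add: energy_inner_def power2_eq_square)
  note [measurable] = domain_measurable[OF w]
  have nn: "0 \<le> \<E> (\<lambda>x. Y k x - w x) (\<lambda>x. Y k x - w x)" for k
    by (intro form_nonneg form.diff_mem YF w)
  have limL: "(\<lambda>k. \<integral>x. (Y k x - w x)\<^sup>2 \<partial>\<mu>) \<longlonglongrightarrow> 0"
    by (rule tendsto_sandwich[OF _ _ tendsto_const lim]) (use nn in auto)
  have limE: "(\<lambda>k. \<E> (\<lambda>x. Y k x - w x) (\<lambda>x. Y k x - w x)) \<longlonglongrightarrow> 0"
    by (rule tendsto_sandwich[OF _ _ tendsto_const lim]) (use nn in auto)
  have intYw: "integrable \<mu> (\<lambda>x. (Y k x - w x)\<^sup>2)" for k
    using form.diff_mem[OF YF w] by (rule domain_square_integrable)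
  have intvw: "integrable \<mu> (\<lambda>x. (v x - w x)\<^sup>2)"
    using integral_square_diff_le(1)[of v \<mu> w "Y 0"] Yint' intYw by simp
  have "(\<lambda>k. 2 * (1 / (real k + 1)) + 2 * (\<integral>x. (Y k x - w x)\<^sup>2 \<partial>\<mu>)) \<longlonglongrightarrow> 2 * 0 + 2 * 0"
    using limL LIMSEQ_inverse_real_of_nat
    by (intro tendsto_intros) (simp_all add: inverse_eq_divide add.commute)
  moreover have "(\<integral>x. (v x - w x)\<^sup>2 \<partial>\<mu>) \<le> 2 * (1 / (real k + 1)) + 2 * (\<integral>x. (Y k x - w x)\<^sup>2 \<partial>\<mu>)" for k
    using integral_square_diff_le(2)[of v \<mu> w "Y k"] Yint' intYw Yle'[of k] by simp
  ultimately have "(\<integral>x. (v x - w x)\<^sup>2 \<partial>\<mu>) \<le> 0"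
    using LIMSEQ_le_const by fastforce
  then have "(\<integral>x. (v x - w x)\<^sup>2 \<partial>\<mu>) = 0" by (intro antisym) auto
  then have ae: "AE x in \<mu>. v x = w x"
    using integral_nonneg_eq_0_iff_AE[OF intvw] by simp
  then have "AE x in \<mu>. w x = v x" by auto
  then show vF: "v \<in> \<F>" using domain_ae[OF w v] by blast
  have "\<E> (\<lambda>x. Y k x - w x) (\<lambda>x. Y k x - w x) = \<E> (\<lambda>x. Y k x - v x) (\<lambda>x. Y k x - v x)" for k
    using ae by (intro quadratic_form_ae form.diff_mem YF w vF) auto
  with limE have "(\<lambda>k. sqrt (\<E> (\<lambda>x. Y k x - v x) (\<lambda>x. Y k x - v x))) \<longlonglongrightarrow> sqrt 0"
    by (intro tendsto_real_sqrt) simp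
  then have limS: "(\<lambda>k. seminorm (\<lambda>x. Y k x - v x)) \<longlonglongrightarrow> 0"
    by (simp add: form.seminorm_def)
  have "seminorm v \<le> sqrt R + seminorm (\<lambda>x. Y k x - v x)" for k
  proof -
    have "seminorm (Y k) \<le> sqrt R" using YR by (simp add: form.seminorm_def)
    then show ?thesis using form.seminorm_reverse_triangle[OF YF vF, of k] by linarith
  qed
  moreover have "(\<lambda>k. sqrt R + seminorm (\<lambda>x. Y k x - v x)) \<longlonglongrightarrow> sqrt R + 0"
    using limS by (intro tendsto_intros)
  ultimately have "seminorm v \<le> sqrt R" using LIMSEQ_le_const by fastforce
  then show "\<E> v v \<le> R" by (simp add: form.seminorm_def)
  have "(\<lambda>k. \<E> (\<lambda>x. Y k x - v x) f) \<longlonglongrightarrow> 0"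
  proof (rule tendsto_rabs_zero_cancel, rule tendsto_sandwich[OF _ _ tendsto_const])
    show "(\<lambda>k. seminorm (\<lambda>x. Y k x - v x) * seminorm f) \<longlonglongrightarrow> 0"
      using limS by (rule tendsto_mult_left_zero)
  qed (use form.cauchy_schwarz form.diff_mem YF vF f in auto)
  then have "(\<lambda>k. \<E> (\<lambda>x. Y k x - v x) f + \<E> v f) \<longlonglongrightarrow> 0 + \<E> v f"
    by (intro tendsto_intros)
  moreover have "c \<le> \<E> (\<lambda>x. Y k x - v x) f + \<E> v f" for k
    using Yc[of k] by (simp add: form.diff YF vF f)
  ultimately show "c \<le> \<E> v f" using LIMSEQ_le_const by fastforce
qed

text \<open>
  Otherwise \<open>\<E> (V n) f\<close>, up to sign, stays above some \<open>c > 0\<close> along a subsequence, and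
  \<open>L2_closed\<close> would give \<open>c \<le> \<E> 0 f\<close>.
\<close>

lemma L2_null_weakly_null:
  assumes V: "\<And>n. V n \<in> \<F>" and R: "\<And>n. seminorm (V n) \<le> r"
    and lim: "(\<lambda>n. \<integral>x. (V n x)\<^sup>2 \<partial>\<mu>) \<longlonglongrightarrow> 0" and f: "f \<in> \<F>"
  shows "(\<lambda>n. \<E> (V n) f) \<longlonglongrightarrow> 0"
proof (rule ccontr)
  assume "\<not> ?thesis"
  then obtain c where c: "0 < c" and inf: "\<And>m. \<exists>n\<ge>m. c \<le> \<bar>\<E> (V n) f\<bar>"
    unfolding LIMSEQ_iff by (auto simp: not_less)
  have "\<exists>y\<in>\<F>. \<E> y y \<le> r\<^sup>2 \<and> c \<le> \<E> y f \<and>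
      integrable \<mu> (\<lambda>x. (y x - 0)\<^sup>2) \<and> (\<integral>x. (y x - 0)\<^sup>2 \<partial>\<mu>) \<le> 1 / (real n + 1)" for n
  proof -
    have "eventually (\<lambda>k. (\<integral>x. (V k x)\<^sup>2 \<partial>\<mu>) < 1 / (real n + 1)) sequentially"
      using lim by (rule order_tendstoD) simp
    then obtain m where m: "\<And>k. m \<le> k \<Longrightarrow> (\<integral>x. (V k x)\<^sup>2 \<partial>\<mu>) < 1 / (real n + 1)"
      by (auto simp: eventually_sequentially)
    obtain k where k: "m \<le> k" "c \<le> \<bar>\<E> (V k) f\<bar>" using inf by blast
    \<comment> \<open>The sign turns the bound on the absolute value into the one-sided bound that is closed under convex combinations.\<close>
    define s where "s = sgn (\<E> (V k) f)"
    define y where "y = (\<lambda>x. s * V k x)"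
    have s2: "s\<^sup>2 = 1" using k c by (auto simp: s_def sgn_if)
    have yF: "y \<in> \<F>" unfolding y_def by (intro form.scale_mem V)
    have "(seminorm (V k))\<^sup>2 \<le> r\<^sup>2"
      using R[of k] form.seminorm_nonneg[OF V] by (intro power_mono) auto
    then have "\<E> y y \<le> r\<^sup>2"
      unfolding y_def by (simp add: form.quadratic_scale V s2 form.seminorm_power2)
    moreover have "c \<le> \<E> y f"
      using k(2) unfolding y_def form.scale[OF V f] by (simp add: s_def abs_sgn mult.commute)
    moreover have "(\<integral>x. (y x)\<^sup>2 \<partial>\<mu>) \<le> 1 / (real n + 1)"
      using m[OF k(1)] by (simp add: y_def power_mult_distrib s2)
    ultimately show ?thesis using yF domain_square_integrable[OF yF] by auto
  qed
  from L2_closed(3)[OF _ f this] have "c \<le> \<E> (\<lambda>x. 0) f" by simp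
  then show False using c form.zero_right[OF f] form_sym[OF form.zero_mem f] by simp
qed

text \<open>
  Scaling the unit contraction shows that \<open>u\<^sup>+ \<and> n\<close> lies in the domain and has energy at
  most \<open>\<E> u u\<close>. These truncations tend to \<open>u\<^sup>+\<close> in \<open>L\<^sup>2\<close>, dominated by \<open>\<bar>u\<bar>\<close>.
\<close>

lemma positive_part_mem: "u \<in> \<F> \<Longrightarrow> (\<lambda>x. max (u x) 0) \<in> \<F>"
  and positive_part_energy:
    "u \<in> \<F> \<Longrightarrow> \<E> (\<lambda>x. max (u x) 0) (\<lambda>x. max (u x) 0) \<le> \<E> u u"
proof -
  have "(\<lambda>x. max (u x) 0) \<in> \<F> \<and> \<E> (\<lambda>x. max (u x) 0) (\<lambda>x. max (u x) 0) \<le> \<E> u u"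
    if u: "u \<in> \<F>" for u
  proof -
    note [measurable] = domain_measurable[OF u]
    define T where "T n = (\<lambda>x. (real n + 1) * min (max (1 / (real n + 1) * u x) 0) 1)" for n
    define P where "P = (\<lambda>x. max (u x) 0)"
    have T_eq: "T n x = min (max (u x) 0) (real n + 1)" for n x
    proof -
      have "(real n + 1) * (1 / (real n + 1) * u x) = u x" by simp
      then show ?thesis
        unfolding T_def by (simp add: min_mult_distrib_left max_mult_distrib_left)
    qed
    have clip: "(\<lambda>x. min (max (1 / (real n + 1) * u x) 0) 1) \<in> \<F>" for n
      by (intro markov_domain form.scale_mem u)
    have T_mem: "T n \<in> \<F>" for n
      unfolding T_def by (intro form.scale_mem clip)
    have T_energy: "\<E> (T n) (T n) \<le> \<E> u u" for n
    proof -
      have "\<E> (T n) (T n) \<le> (real n + 1)\<^sup>2 * \<E> (\<lambda>x. 1 / (real n + 1) * u x) (\<lambda>x. 1 / (real n + 1) * u x)"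
        unfolding T_def form.quadratic_scale[OF clip]
        by (intro mult_left_mono markov_form form.scale_mem u) auto
      also have "\<dots> = \<E> u u"
        unfolding form.quadratic_scale[OF u] by (simp add: power_divide)
      finally show ?thesis .
    qed
    have "AE x in \<mu>. (\<lambda>n. T n x - P x) \<longlonglongrightarrow> 0"
    proof (rule AE_I2, rule tendsto_eventually)
      fix x
      obtain m :: nat where "u x < real m" using reals_Archimedean2 by blast
      then have "T n x - P x = 0" if "m \<le> n" for n
        using that by (auto simp: T_eq P_def)
      then show "eventually (\<lambda>n. T n x - P x = 0) sequentially"
        by (auto simp: eventually_sequentially)
    qed
    moreover have "\<bar>T n x - P x\<bar> \<le> \<bar>u x\<bar>" for n x by (auto simp: T_eq P_def)
    moreover have [measurable]: "T n \<in> borel_measurable \<mu>" "P \<in> borel_measurable \<mu>" for n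
      unfolding T_def P_def by measurable
    ultimately have int: "integrable \<mu> (\<lambda>x. (T n x - P x)\<^sup>2)"
      and lim: "(\<lambda>n. \<integral>x. (T n x - P x)\<^sup>2 \<partial>\<mu>) \<longlonglongrightarrow> 0" for n
      using integral_square_tendsto_0[of "\<lambda>n x. T n x - P x" \<mu> u] u domain_L2 by auto
    have "\<exists>y\<in>\<F>. \<E> y y \<le> \<E> u u \<and> 0 \<le> \<E> y (\<lambda>x. 0) \<and>
      integrable \<mu> (\<lambda>x. (y x - P x)\<^sup>2) \<and> (\<integral>x. (y x - P x)\<^sup>2 \<partial>\<mu>) \<le> 1 / (real n + 1)" for n
    proof -
      have "eventually (\<lambda>k. (\<integral>x. (T k x - P x)\<^sup>2 \<partial>\<mu>) < 1 / (real n + 1)) sequentially"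
        using lim by (rule order_tendstoD) simp
      then obtain k where "(\<integral>x. (T k x - P x)\<^sup>2 \<partial>\<mu>) < 1 / (real n + 1)"
        by (auto simp: eventually_sequentially)
      then show ?thesis
        using T_mem[of k] T_energy[of k] int[of k] by (auto intro!: bexI[of _ "T k"] simp: form.zero_right)
    qed
    from L2_closed(1,2)[OF _ form.zero_mem this] show ?thesis
      unfolding P_def by auto
  qed
  then show "u \<in> \<F> \<Longrightarrow> (\<lambda>x. max (u x) 0) \<in> \<F>"
    "u \<in> \<F> \<Longrightarrow> \<E> (\<lambda>x. max (u x) 0) (\<lambda>x. max (u x) 0) \<le> \<E> u u" by blast+
qed

lemma negative_part_mem: "u \<in> \<F> \<Longrightarrow> (\<lambda>x. max (- u x) 0) \<in> \<F>"
  and negative_part_energy: "u \<in> \<F> \<Longrightarrow> \<E> (\<lambda>x. max (- u x) 0) (\<lambda>x. max (- u x) 0) \<le> \<E> u u"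
  using positive_part_mem[OF form.scale_mem, of u "-1"]
    positive_part_energy[OF form.scale_mem, of u "-1"] form.quadratic_scale[of u "-1"] by auto

text \<open>
  For \<open>t > 0\<close> the positive part of \<open>u\<^sup>+ - t u\<^sup>-\<close> is \<open>u\<^sup>+\<close>, so that the energy of \<open>u\<^sup>+ - t u\<^sup>-\<close> is
  at least that of \<open>u\<^sup>+\<close>; the term linear in \<open>t\<close> must therefore be non-negative.
\<close>

lemma positive_negative_part_form_le_0:
  assumes u: "u \<in> \<F>"
  shows "\<E> (\<lambda>x. max (u x) 0) (\<lambda>x. max (- u x) 0) \<le> 0"
proof -
  define p n where "p = (\<lambda>x. max (u x) 0)" and "n = (\<lambda>x. max (- u x) 0)"
  have mem: "p \<in> \<F>" "n \<in> \<F>"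
    unfolding p_def n_def by (intro positive_part_mem negative_part_mem u)+
  have *: "2 * \<E> p n \<le> t * \<E> n n" if t: "0 < t" for t
  proof -
    have "(\<lambda>x. max (p x - t * n x) 0) = p"
      using t by (auto simp: p_def n_def max_def mult_nonneg_nonpos mult_pos_neg not_le)
    then have "\<E> p p \<le> \<E> (\<lambda>x. p x - t * n x) (\<lambda>x. p x - t * n x)"
      using positive_part_energy[OF form.diff_mem[OF mem(1) form.scale_mem[OF mem(2), of t]]] by simp
    also have "\<dots> = \<E> p p - 2 * t * \<E> p n + t\<^sup>2 * \<E> n n"
      by (simp add: form.quadratic_diff form.scale_mem mem form.quadratic_scale form.scale_right)
    finally have "t * (2 * \<E> p n) \<le> t * (t * \<E> n n)" by (simp add: power2_eq_square algebra_simps)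
    then show ?thesis using t by simp
  qed
  have "\<E> p n \<le> 0"
  proof (rule ccontr)
    assume "\<not> ?thesis"
    then have pos: "0 < \<E> p n" by simp
    have "0 \<le> \<E> n n" using form_nonneg mem by blast
    \<comment> \<open>The choice of \<open>t\<close> makes the right-hand side smaller than \<open>\<E> p n\<close>; adding \<open>1\<close> avoids a division by \<open>0\<close>.\<close>
    moreover have "2 * \<E> p n \<le> \<E> p n / (\<E> n n + 1) * \<E> n n"
      using pos calculation by (intro *) auto
    moreover have "\<dots> \<le> \<E> p n"
      using pos calculation by (simp add: field_simps)
    ultimately show False using pos by simp
  qed
  then show ?thesis by (simp add: p_def n_def)
qed

text \<open>
  All three facts come from \<open>a \<and> g = a - (a - g)\<^sup>+\<close>: the two differences in the last one are the
  positive and the negative part of \<open>a - g\<close>.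
\<close>

lemma min_mem:
  assumes a: "a \<in> \<F>" and g: "g \<in> \<F>"
  shows "(\<lambda>x. min (a x) (g x)) \<in> \<F>"
    and "seminorm (\<lambda>x. min (a x) (g x)) \<le> 2 * seminorm a + seminorm g"
    and "\<E> (\<lambda>x. a x - min (a x) (g x)) (\<lambda>x. g x - min (a x) (g x)) \<le> 0"
proof -
  define p where "p = (\<lambda>x. max (a x - g x) 0)"
  have d: "(\<lambda>x. a x - g x) \<in> \<F>" using a g by (rule form.diff_mem)
  have p: "p \<in> \<F>" unfolding p_def using d by (rule positive_part_mem)
  have min_eq: "(\<lambda>x. min (a x) (g x)) = (\<lambda>x. a x - p x)"
    by (auto simp: p_def)
  show "(\<lambda>x. min (a x) (g x)) \<in> \<F>"
    unfolding min_eq using a p by (rule form.diff_mem)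
  have "seminorm p \<le> seminorm (\<lambda>x. a x - g x)"
    unfolding form.seminorm_def p_def using positive_part_energy[OF d] by simp
  also have "\<dots> \<le> seminorm a + seminorm g" using a g by (rule form.seminorm_diff)
  finally show "seminorm (\<lambda>x. min (a x) (g x)) \<le> 2 * seminorm a + seminorm g"
    unfolding min_eq using form.seminorm_diff[OF a p] by linarith
  have "(\<lambda>x. a x - min (a x) (g x)) = (\<lambda>x. max (a x - g x) 0)"
    "(\<lambda>x. g x - min (a x) (g x)) = (\<lambda>x. max (- (a x - g x)) 0)" by auto
  then show "\<E> (\<lambda>x. a x - min (a x) (g x)) (\<lambda>x. g x - min (a x) (g x)) \<le> 0"
    using positive_negative_part_form_le_0[OF d] by simp
qed

end

section \<open>Energy-Cauchy sequences that vanish in the limit\<close>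

context dirichlet_form
begin

text \<open>
  Truncation by \<open>g \<ge> 0\<close> supplies the domination that almost everywhere convergence lacks: the
  functions \<open>A n \<and> g\<close> are null in \<open>L\<^sup>2\<close> and bounded in energy, hence weakly null. As \<open>A\<close> is Cauchy,
  \<open>\<E> (A n) (A n \<and> g)\<close> tends to \<open>0\<close> too, and \<open>min_mem\<close> bounds \<open>\<E> (A n) g\<close> from above by null
  sequences. Non-negativity allows to use this for \<open>g = A m\<close>.
\<close>

lemma nonneg_cauchy_null:
  assumes A: "\<And>n. A n \<in> \<F>" and pos: "\<And>n x. 0 \<le> A n x" and cauchy: "form_cauchy \<E> A"
    and lim: "AE x in \<mu>. (\<lambda>n. A n x) \<longlonglongrightarrow> 0"
  shows "(\<lambda>n. seminorm (A n)) \<longlonglongrightarrow> 0"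
proof -
  obtain R where R: "0 < R" "\<And>n. seminorm (A n) \<le> R"
    using form.cauchy_seminorm_bounded[OF A cauchy] by blast
  have eventually_le: "eventually (\<lambda>n. \<E> (A n) g < e) sequentially"
    if g: "g \<in> \<F>" and g_pos: "\<And>x. 0 \<le> g x" and e: "0 < e" for g e
  proof -
    define W where "W n = (\<lambda>x. min (A n x) (g x))" for n
    define r where "r = 2 * R + seminorm g"
    have r: "0 < r" using R form.seminorm_nonneg[OF g] by (simp add: r_def)
    have W: "W n \<in> \<F>" for n unfolding W_def by (intro min_mem A g)
    have Wr: "seminorm (W n) \<le> r" for n
      using min_mem(2)[OF A[of n] g] R(2)[of n] unfolding W_def r_def by linarith
    have "(\<lambda>n. \<integral>x. (W n x)\<^sup>2 \<partial>\<mu>) \<longlonglongrightarrow> 0"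
    proof (rule integral_square_tendsto_0(2))
      show "W n \<in> borel_measurable \<mu>" for n using W by (rule domain_measurable)
      show "g \<in> Lq_space \<mu> 2" using g domain_L2 by blast
      show "AE x in \<mu>. (\<lambda>n. W n x) \<longlonglongrightarrow> 0"
        using lim
      proof eventually_elim
        case (elim x)
        then have "(\<lambda>n. min (A n x) (g x)) \<longlonglongrightarrow> min 0 (g x)" by (intro tendsto_intros)
        then show ?case using g_pos[of x] by (simp add: W_def)
      qed
      show "\<bar>W n x\<bar> \<le> \<bar>g x\<bar>" for n x using pos[of n x] g_pos[of x] by (simp add: W_def)
    qed
    then have weak: "(\<lambda>n. \<E> (W n) f) \<longlonglongrightarrow> 0" if "f \<in> \<F>" for f
      using L2_null_weakly_null[of W r f, OF W Wr _ that] by simp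
    have "0 < e / (3 * r)" using e r by simp
    then obtain m where m: "\<And>k l. \<lbrakk>m \<le> k; m \<le> l\<rbrakk> \<Longrightarrow> seminorm (\<lambda>x. A k x - A l x) < e / (3 * r)"
      using form.cauchy_seminormD[OF cauchy A] by blast
    have "eventually (\<lambda>n. \<E> (W n) (A m) < e / 3) sequentially"
      using weak[OF A] by (rule order_tendstoD) (use e in simp)
    moreover have "eventually (\<lambda>n. \<E> (W n) g < e / 3) sequentially"
      using weak[OF g] by (rule order_tendstoD) (use e in simp)
    moreover have "eventually (\<lambda>n. m \<le> n) sequentially" by (rule eventually_ge_at_top)
    ultimately show ?thesis
    proof eventually_elim
      case (elim n)
      have "\<E> (\<lambda>x. A n x - A m x) (W n) \<le> seminorm (\<lambda>x. A n x - A m x) * seminorm (W n)"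
        using form.cauchy_schwarz[OF form.diff_mem[OF A A] W, of n m n] by linarith
      also have "\<dots> \<le> e / (3 * r) * r"
        using m[of n m] elim Wr[of n] form.seminorm_nonneg[OF W, of n] e r
        by (intro mult_mono) simp_all
      also have "\<dots> = e / 3" using r by simp
      finally have "\<E> (A n) (W n) \<le> e / 3 + \<E> (A m) (W n)"
        by (simp add: form.diff A W)
      moreover have "\<E> (\<lambda>x. A n x - W n x) (\<lambda>x. g x - W n x) \<le> 0"
        using min_mem(3)[OF A[of n] g] by (simp add: W_def)
      then have "\<E> (A n) g - \<E> (W n) g - (\<E> (A n) (W n) - \<E> (W n) (W n)) \<le> 0"
        by (simp add: form.diff form.diff_right form.diff_mem A W g)
      moreover have "0 \<le> \<E> (W n) (W n)" using W by (rule form_nonneg)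
      moreover have "\<E> (A m) (W n) = \<E> (W n) (A m)" by (rule form_sym[OF A W])
      ultimately show ?case using elim(1,2) by linarith
    qed
  qed
  have "(\<lambda>n. \<E> (A n) (A n)) \<longlonglongrightarrow> 0"
  proof (rule order_tendstoI)
    fix e :: real assume e: "0 < e"
    have "0 < e / (2 * R)" using e R by simp
    then obtain m where m: "\<And>k l. \<lbrakk>m \<le> k; m \<le> l\<rbrakk> \<Longrightarrow> seminorm (\<lambda>x. A k x - A l x) < e / (2 * R)"
      using form.cauchy_seminormD[OF cauchy A] by blast
    have "eventually (\<lambda>n. \<E> (A n) (A m) < e / 2) sequentially"
      using e pos by (intro eventually_le A) auto
    moreover have "eventually (\<lambda>n. m \<le> n) sequentially" by (rule eventually_ge_at_top)
    ultimately show "eventually (\<lambda>n. \<E> (A n) (A n) < e) sequentially"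
    proof eventually_elim
      case (elim n)
      have "\<E> (A n) (\<lambda>x. A n x - A m x) \<le> seminorm (A n) * seminorm (\<lambda>x. A n x - A m x)"
        using form.cauchy_schwarz[OF A form.diff_mem[OF A A], of n n m] by linarith
      also have "\<dots> \<le> R * (e / (2 * R))"
        using m[of n m] elim R(1) R(2)[of n]
          form.seminorm_nonneg[OF form.diff_mem[OF A A], of n m]
        by (intro mult_mono) simp_all
      also have "\<dots> = e / 2" using R by simp
      finally show ?case using elim(1) by (simp add: form.diff_right A)
    qed
  next
    fix e :: real assume "e < 0"
    then show "eventually (\<lambda>n. e < \<E> (A n) (A n)) sequentially"
      by (intro always_eventually allI less_le_trans[OF _ form_nonneg[OF A]])
  qed
  then have "(\<lambda>n. sqrt (\<E> (A n) (A n))) \<longlonglongrightarrow> sqrt 0" by (rule tendsto_real_sqrt)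
  then show ?thesis by (simp add: form.seminorm_def)
qed

text \<open>
  The positive and negative parts of \<open>U n\<close> tend to \<open>0\<close> and are bounded in energy, but need not be
  Cauchy. They are replaced by convex combinations with late indices, using the same weights for
  both, which are Cauchy by \<open>minimizing_sequence\<close>. The difference \<open>A n - B n\<close> then behaves like a convex
  combination of late members of \<open>U\<close>, so it is close to \<open>U n\<close> in energy.
\<close>

lemma cauchy_null:
  assumes U: "\<And>n. U n \<in> \<F>" and cauchy: "form_cauchy \<E> U"
    and lim: "AE x in \<mu>. (\<lambda>n. U n x) \<longlonglongrightarrow> 0"
  shows "(\<lambda>n. seminorm (U n)) \<longlonglongrightarrow> 0"
proof -
  obtain R where R: "0 < R" "\<And>n. seminorm (U n) \<le> R"
    using form.cauchy_seminorm_bounded[OF U cauchy] by blast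
  \<comment> \<open>Instead of convex combinations themselves, \<open>C N\<close> collects pairs with the properties that the
    combinations of parts of \<open>U n\<close>, \<open>n \<ge> N\<close>, inherit: \<open>a\<close> and \<open>b\<close> obey every common pointwise
    bound of the tail, and \<open>a - b\<close> lies in every energy ball containing the tail. These properties are
    visibly preserved by midpoints.\<close>
  define C where "C N = {(a, b). a \<in> \<F> \<and> b \<in> \<F> \<and> (\<forall>x. 0 \<le> a x \<and> 0 \<le> b x) \<and>
    (\<forall>x c. (\<forall>n\<ge>N. \<bar>U n x\<bar> \<le> c) \<longrightarrow> a x \<le> c \<and> b x \<le> c) \<and>
    (\<forall>v\<in>\<F>. \<forall>c. (\<forall>n\<ge>N. seminorm (\<lambda>x. U n x - v x) \<le> c) \<longrightarrow>
       seminorm (\<lambda>x. (a x - b x) - v x) \<le> c)}" for N :: nat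
  define Q where "Q = (\<lambda>(a, b). \<E> a a + \<E> b b)"
  define D where "D = (\<lambda>(a, b) (a', b').
    (\<E> (\<lambda>x. a x - a' x) (\<lambda>x. a x - a' x) + \<E> (\<lambda>x. b x - b' x) (\<lambda>x. b x - b' x)) / 4)"
  have "\<exists>Y. (\<forall>n. Y n \<in> C n) \<and> (\<forall>e>0. \<exists>n. \<forall>k\<ge>n. \<forall>l\<ge>n. D (Y k) (Y l) < e)"
  proof (rule minimizing_sequence[where Q = Q and R = "2 * R\<^sup>2"])
    show "\<exists>y\<in>C n. Q y \<le> 2 * R\<^sup>2" for n
    proof (rule bexI)
      let ?p = "\<lambda>x. max (U n x) 0" and ?m = "\<lambda>x. max (- U n x) 0"
      have "(seminorm (U n))\<^sup>2 \<le> R\<^sup>2"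
        using R form.seminorm_nonneg[OF U] by (intro power_mono) auto
      then show "Q (?p, ?m) \<le> 2 * R\<^sup>2"
        using positive_part_energy[OF U, of n] negative_part_energy[OF U, of n]
        by (simp add: Q_def form.seminorm_power2[OF U])
      have eq: "(\<lambda>x. (?p x - ?m x) - v x) = (\<lambda>x. U n x - v x)" for v by auto
      show "(?p, ?m) \<in> C n"
        unfolding C_def mem_Collect_eq case_prod_conv eq
      proof (intro conjI allI ballI impI positive_part_mem[OF U] negative_part_mem[OF U])
        fix x c assume "\<forall>k\<ge>n. \<bar>U k x\<bar> \<le> c"
        then have "\<bar>U n x\<bar> \<le> c" by blast
        then show "max (U n x) 0 \<le> c" "max (- U n x) 0 \<le> c" by auto
      next
        fix v c assume "\<forall>k\<ge>n. seminorm (\<lambda>x. U k x - v x) \<le> c"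
        then show "seminorm (\<lambda>x. U n x - v x) \<le> c" by blast
      qed auto
    qed
    show "C n \<subseteq> C m" if "m \<le> n" for m n
    proof -
      have later: "\<forall>k\<ge>n. P k" if "\<forall>k\<ge>m. P k" for P using that \<open>m \<le> n\<close> by simp
      show ?thesis unfolding C_def by (auto dest: later)
    qed
    show "0 \<le> Q y" if "y \<in> C n" for n y
      using that form_nonneg by (auto simp: C_def Q_def)
    show "\<exists>m\<in>C n. Q m \<le> (Q y + Q z) / 2 - D y z" if y: "y \<in> C n" and z: "z \<in> C n" for n y z
    proof -
      obtain a b where y_eq: "y = (a, b)" by (cases y)
      obtain a' b' where z_eq: "z = (a', b')" by (cases z)
      define c d where "c = (\<lambda>x. (a x + a' x) / 2)" and "d = (\<lambda>x. (b x + b' x) / 2)"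
      have mem: "a \<in> \<F>" "b \<in> \<F>" "a' \<in> \<F>" "b' \<in> \<F>"
        using y z by (auto simp: C_def y_eq z_eq)
      have "Q (c, d) = (Q y + Q z) / 2 - D y z"
        unfolding c_def d_def Q_def D_def y_eq z_eq case_prod_conv
          form.quadratic_half[OF mem(1,3)] form.quadratic_half[OF mem(2,4)] by argo
      moreover have "(c, d) \<in> C n"
      proof -
        have "c \<in> \<F>" "d \<in> \<F>" unfolding c_def d_def using mem by (auto intro: form.half_mem)
        moreover have "0 \<le> c x \<and> 0 \<le> d x" for x
          using y z by (simp add: C_def y_eq z_eq c_def d_def)
        moreover have "c x \<le> s \<and> d x \<le> s" if "\<forall>k\<ge>n. \<bar>U k x\<bar> \<le> s" for x s
        proof -
          have "a x \<le> s" "b x \<le> s" "a' x \<le> s" "b' x \<le> s"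
            using y z that by (auto simp: C_def y_eq z_eq)
          then show ?thesis by (simp add: c_def d_def)
        qed
        moreover have "seminorm (\<lambda>x. (c x - d x) - v x) \<le> s"
          if v: "v \<in> \<F>" and s: "\<forall>k\<ge>n. seminorm (\<lambda>x. U k x - v x) \<le> s" for v s
        proof -
          let ?f = "\<lambda>x. (a x - b x) - v x" and ?g = "\<lambda>x. (a' x - b' x) - v x"
          have fg: "?f \<in> \<F>" "?g \<in> \<F>" using mem v by (auto intro!: form.diff_mem)
          have "(\<lambda>x. (c x - d x) - v x) = (\<lambda>x. 1/2 * (?f x + ?g x))"
            by (auto simp: c_def d_def field_simps)
          then have "seminorm (\<lambda>x. (c x - d x) - v x) = 1/2 * seminorm (\<lambda>x. ?f x + ?g x)"
            using form.seminorm_scale[OF form.add_mem[OF fg], of "1/2"] by simp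
          also have "\<dots> \<le> 1/2 * (seminorm ?f + seminorm ?g)"
            using form.seminorm_add[OF fg] by simp
          also have "\<dots> \<le> 1/2 * (s + s)"
            using y z v s by (intro mult_left_mono add_mono) (auto simp: C_def y_eq z_eq)
          finally show ?thesis by simp
        qed
        ultimately show ?thesis unfolding C_def by blast
      qed
      ultimately show ?thesis by (intro bexI[of _ "(c, d)"]) simp_all
    qed
  qed
  then obtain Y where YC: "\<And>n. Y n \<in> C n"
    and YD: "\<And>e. 0 < e \<Longrightarrow> \<exists>n. \<forall>k\<ge>n. \<forall>l\<ge>n. D (Y k) (Y l) < e" by blast
  define A B where "A n = fst (Y n)" and "B n = snd (Y n)" for n
  have Y_eq: "Y n = (A n, B n)" for n by (simp add: A_def B_def)
  have mem: "A n \<in> \<F>" "B n \<in> \<F>" and AB_pos: "0 \<le> A n x" "0 \<le> B n x" for n x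
    using YC[of n] unfolding Y_eq C_def by auto
  have AB_le: "A n x \<le> c \<and> B n x \<le> c" if "\<And>k. n \<le> k \<Longrightarrow> \<bar>U k x\<bar> \<le> c" for n x c
    using YC[of n] that unfolding Y_eq C_def by auto
  have AB_close: "seminorm (\<lambda>x. (A n x - B n x) - v x) \<le> c"
    if "v \<in> \<F>" "\<And>k. n \<le> k \<Longrightarrow> seminorm (\<lambda>x. U k x - v x) \<le> c" for n v c
    using YC[of n] that unfolding Y_eq C_def by auto
  have AB_null: "AE x in \<mu>. (\<lambda>n. A n x) \<longlonglongrightarrow> 0 \<and> (\<lambda>n. B n x) \<longlonglongrightarrow> 0"
    using lim
  proof eventually_elim
    case (elim x)
    have "\<exists>N. \<forall>n\<ge>N. norm (A n x) < e \<and> norm (B n x) < e" if e: "0 < e" for e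
    proof -
      obtain N where N: "\<forall>n\<ge>N. \<bar>U n x\<bar> < e / 2"
        using elim e unfolding LIMSEQ_iff by (auto dest: spec[of _ "e / 2"])
      have "norm (A n x) < e \<and> norm (B n x) < e" if "N \<le> n" for n
      proof -
        have "A n x \<le> e / 2 \<and> B n x \<le> e / 2"
        proof (rule AB_le)
          fix k assume "n \<le> k"
          then show "\<bar>U k x\<bar> \<le> e / 2" using N[rule_format, of k] that by simp
        qed
        then show ?thesis using AB_pos[of n x] AB_pos(2)[of n x] e by simp
      qed
      then show ?thesis by blast
    qed
    then show ?case unfolding LIMSEQ_iff by (metis diff_zero)
  qed
  have "form_cauchy \<E> A \<and> form_cauchy \<E> B"
  proof -
    have "\<exists>n. \<forall>k\<ge>n. \<forall>l\<ge>n. \<E> (\<lambda>x. A k x - A l x) (\<lambda>x. A k x - A l x) < e \<and>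
        \<E> (\<lambda>x. B k x - B l x) (\<lambda>x. B k x - B l x) < e" if e: "0 < e" for e
    proof -
      obtain n where n: "\<forall>k\<ge>n. \<forall>l\<ge>n. D (Y k) (Y l) < e / 4" using YD[of "e / 4"] e by auto
      have "\<E> (\<lambda>x. A k x - A l x) (\<lambda>x. A k x - A l x) < e \<and>
          \<E> (\<lambda>x. B k x - B l x) (\<lambda>x. B k x - B l x) < e" if "n \<le> k" "n \<le> l" for k l
      proof -
        have "0 \<le> \<E> (\<lambda>x. A k x - A l x) (\<lambda>x. A k x - A l x)"
          "0 \<le> \<E> (\<lambda>x. B k x - B l x) (\<lambda>x. B k x - B l x)"
          using mem by (auto intro!: form_nonneg form.diff_mem)
        moreover have "D (Y k) (Y l) < e / 4" using n that by blast
        ultimately show ?thesis unfolding D_def Y_eq by simp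
      qed
      then show ?thesis by blast
    qed
    then show ?thesis unfolding form_cauchy_def by blast
  qed
  then have "(\<lambda>n. seminorm (A n)) \<longlonglongrightarrow> 0" "(\<lambda>n. seminorm (B n)) \<longlonglongrightarrow> 0"
    using AB_null mem AB_pos by (auto intro!: nonneg_cauchy_null)
  moreover have "(\<lambda>n. seminorm (\<lambda>x. (A n x - B n x) - U n x)) \<longlonglongrightarrow> 0"
  proof (rule LIMSEQ_I)
    fix e :: real assume e: "0 < e"
    obtain N where N: "\<And>k l. \<lbrakk>N \<le> k; N \<le> l\<rbrakk> \<Longrightarrow> seminorm (\<lambda>x. U k x - U l x) < e / 2"
      using form.cauchy_seminormD[OF cauchy U half_gt_zero[OF e]] by blast
    have "norm (seminorm (\<lambda>x. (A n x - B n x) - U n x) - 0) < e" if "N \<le> n" for n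
    proof -
      have "seminorm (\<lambda>x. (A n x - B n x) - U n x) \<le> e / 2"
      proof (rule AB_close[OF U])
        fix k assume "n \<le> k"
        then show "seminorm (\<lambda>x. U k x - U n x) \<le> e / 2"
          using N[of k n] that by simp
      qed
      moreover have "0 \<le> seminorm (\<lambda>x. (A n x - B n x) - U n x)"
        by (intro form.seminorm_nonneg form.diff_mem mem U)
      ultimately show ?thesis using e by simp
    qed
    then show "\<exists>N. \<forall>n\<ge>N. norm (seminorm (\<lambda>x. (A n x - B n x) - U n x) - 0) < e" by blast
  qed
  ultimately have lim3: "(\<lambda>n. seminorm (A n) + seminorm (B n) +
      seminorm (\<lambda>x. (A n x - B n x) - U n x)) \<longlonglongrightarrow> 0 + 0 + 0"
    by (intro tendsto_add)
  show ?thesis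
  proof (rule tendsto_sandwich[OF always_eventually always_eventually tendsto_const lim3[simplified]])
    show "\<forall>n. 0 \<le> seminorm (U n)" using form.seminorm_nonneg[OF U] by simp
    show "\<forall>n. seminorm (U n)
        \<le> seminorm (A n) + seminorm (B n) + seminorm (\<lambda>x. (A n x - B n x) - U n x)"
    proof
      fix n
      show "seminorm (U n)
          \<le> seminorm (A n) + seminorm (B n) + seminorm (\<lambda>x. (A n x - B n x) - U n x)"
        using form.seminorm_reverse_triangle[OF form.diff_mem[OF mem] U, of n n n]
          form.seminorm_diff[OF mem, of n n] by linarith
    qed
  qed
qed

section \<open>The quadratic form on the extended domain\<close>

abbreviation approximates where "approximates \<equiv> approximating_sequence \<mu> \<F> \<E>"
abbreviation \<F>\<^sub>e where "\<F>\<^sub>e \<equiv> extended_domain \<mu> \<F> \<E>"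
abbreviation \<E>\<^sub>e where "\<E>\<^sub>e \<equiv> extended_energy \<mu> \<F> \<E>"

lemma approximates_add:
  assumes "approximates U u" "approximates W w"
  shows "approximates (\<lambda>k x. U k x + W k x) (\<lambda>x. u x + w x)"
  unfolding approximating_sequence_def
proof (intro conjI allI)
  show "(\<lambda>x. U k x + W k x) \<in> \<F>" for k
    using assms by (auto simp: approximating_sequence_def intro: form.add_mem)
  show "form_cauchy \<E> (\<lambda>k x. U k x + W k x)"
    using assms by (auto simp: approximating_sequence_def intro: form.cauchy_add)
  have "AE x in \<mu>. (\<lambda>k. U k x) \<longlonglongrightarrow> u x" "AE x in \<mu>. (\<lambda>k. W k x) \<longlonglongrightarrow> w x"
    using assms by (auto simp: approximating_sequence_def)
  then show "AE x in \<mu>. (\<lambda>k. U k x + W k x) \<longlonglongrightarrow> u x + w x"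
    by eventually_elim (intro tendsto_add)
qed

lemma approximates_scale:
  assumes "approximates U u"
  shows "approximates (\<lambda>k x. c * U k x) (\<lambda>x. c * u x)"
  unfolding approximating_sequence_def
proof (intro conjI allI)
  show "(\<lambda>x. c * U k x) \<in> \<F>" for k
    using assms by (auto simp: approximating_sequence_def intro: form.scale_mem)
  show "form_cauchy \<E> (\<lambda>k x. c * U k x)"
    using assms by (auto simp: approximating_sequence_def intro: form.cauchy_scale)
  have "AE x in \<mu>. (\<lambda>k. U k x) \<longlonglongrightarrow> u x"
    using assms by (auto simp: approximating_sequence_def)
  then show "AE x in \<mu>. (\<lambda>k. c * U k x) \<longlonglongrightarrow> c * u x"
    by eventually_elim (intro tendsto_intros)
qed

lemma approximates_diff:
  assumes "approximates U u" "approximates W w"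
  shows "approximates (\<lambda>k x. U k x - W k x) (\<lambda>x. u x - w x)"
  using approximates_add[OF assms(1) approximates_scale[OF assms(2), of "-1"]] by simp

text \<open>
  Two approximating sequences of \<open>u\<close> differ by a Cauchy sequence that tends to \<open>0\<close> almost
  everywhere, so \<open>cauchy_null\<close> makes their energies have the same limit.
\<close>

lemma approximates_energy:
  assumes U: "approximates U u"
  shows "(\<lambda>k. \<E> (U k) (U k)) \<longlonglongrightarrow> \<E>\<^sub>e u"
proof -
  have "\<exists>e. (\<lambda>k. \<E> (U k) (U k)) \<longlonglongrightarrow> e"
  proof -
    have mem: "\<And>k. U k \<in> \<F>" and "form_cauchy \<E> U"
      using U by (auto simp: approximating_sequence_def)
    then obtain s where "(\<lambda>k. seminorm (U k)) \<longlonglongrightarrow> s"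
      using form.cauchy_seminorm_convergent by (auto simp: convergent_def)
    then have "(\<lambda>k. (seminorm (U k))\<^sup>2) \<longlonglongrightarrow> s\<^sup>2" by (rule tendsto_power)
    then show ?thesis by (auto simp: form.seminorm_power2[OF mem])
  qed
  then obtain e where e: "(\<lambda>k. \<E> (U k) (U k)) \<longlonglongrightarrow> e" by blast
  have "e' = e" if W: "approximates W u" and e': "(\<lambda>k. \<E> (W k) (W k)) \<longlonglongrightarrow> e'" for W e'
  proof -
    have mem: "U k \<in> \<F>" "W k \<in> \<F>" for k using U W by (auto simp: approximating_sequence_def)
    have "approximates (\<lambda>k x. W k x - U k x) (\<lambda>x. 0)"
      using approximates_diff[OF W U] by simp
    then have "(\<lambda>k. seminorm (\<lambda>x. W k x - U k x)) \<longlonglongrightarrow> 0"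
      unfolding approximating_sequence_def by (intro cauchy_null) auto
    then have "(\<lambda>k. seminorm (W k) - seminorm (U k)) \<longlonglongrightarrow> 0"
      by (rule Lim_null_comparison[rotated])
        (use form.seminorm_reverse_triangle mem in \<open>auto intro!: always_eventually\<close>)
    moreover have "(\<lambda>k. seminorm (W k) - seminorm (U k)) \<longlonglongrightarrow> sqrt e' - sqrt e"
      unfolding form.seminorm_def by (intro tendsto_diff tendsto_real_sqrt e e')
    ultimately have "sqrt e' - sqrt e = 0" using LIMSEQ_unique by blast
    then show ?thesis by simp
  qed
  then have "\<E>\<^sub>e u = e"
    unfolding extended_energy_def using U e by (intro the_equality exI[of _ U] conjI) blast+
  with e show ?thesis by simp
qed

lemma approximates_seminorm:
  assumes "approximates U u"
  shows "(\<lambda>k. seminorm (U k)) \<longlonglongrightarrow> sqrt (\<E>\<^sub>e u)"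
  unfolding form.seminorm_def by (intro tendsto_real_sqrt approximates_energy assms)

lemma extended_domain_approximates:
  assumes "u \<in> \<F>\<^sub>e"
  obtains U where "approximates U u" "\<And>k. U k \<in> \<F>"
  using assms by (auto simp: extended_domain_def approximating_sequence_def)

lemma extended_null:
  assumes "u \<in> borel_measurable \<mu>" "AE x in \<mu>. u x = 0"
  shows "u \<in> \<F>\<^sub>e" "\<E>\<^sub>e u = 0"
proof -
  have "form_cauchy \<E> (\<lambda>k x. 0)"
    by (simp add: form_cauchy_def form.zero_right form.zero_mem)
  moreover have "AE x in \<mu>. (\<lambda>k::nat. 0) \<longlonglongrightarrow> u x"
    using assms(2) by eventually_elim simp
  ultimately have appr: "approximates (\<lambda>k x. 0) u"
    by (simp add: approximating_sequence_def form.zero_mem)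
  then show "u \<in> \<F>\<^sub>e" using assms(1) by (auto simp: extended_domain_def)
  from approximates_energy[OF appr] show "\<E>\<^sub>e u = 0"
    by (simp add: form.zero_right form.zero_mem LIMSEQ_const_iff)
qed

lemma extended_add: "\<lbrakk>u \<in> \<F>\<^sub>e; v \<in> \<F>\<^sub>e\<rbrakk> \<Longrightarrow> (\<lambda>x. u x + v x) \<in> \<F>\<^sub>e"
  unfolding extended_domain_def using approximates_add by fastforce

lemma extended_scale: "u \<in> \<F>\<^sub>e \<Longrightarrow> (\<lambda>x. c * u x) \<in> \<F>\<^sub>e"
  unfolding extended_domain_def using approximates_scale by fastforce

lemma extended_energy_nonneg:
  assumes "u \<in> \<F>\<^sub>e" shows "0 \<le> \<E>\<^sub>e u"
proof -
  obtain U where U: "approximates U u" "\<And>k. U k \<in> \<F>"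
    using extended_domain_approximates[OF assms] by blast
  show ?thesis
    by (rule LIMSEQ_le_const[OF approximates_energy[OF U(1)]]) (use form_nonneg U(2) in auto)
qed

lemma extended_energy_scale:
  assumes "u \<in> \<F>\<^sub>e" shows "\<E>\<^sub>e (\<lambda>x. c * u x) = c\<^sup>2 * \<E>\<^sub>e u"
proof -
  obtain U where U: "approximates U u" "\<And>k. U k \<in> \<F>"
    using extended_domain_approximates[OF assms] by blast
  have "(\<lambda>k. c\<^sup>2 * \<E> (U k) (U k)) \<longlonglongrightarrow> \<E>\<^sub>e (\<lambda>x. c * u x)"
    using approximates_energy[OF approximates_scale[OF U(1), of c]] U(2)
    by (simp add: form.quadratic_scale)
  moreover have "(\<lambda>k. c\<^sup>2 * \<E> (U k) (U k)) \<longlonglongrightarrow> c\<^sup>2 * \<E>\<^sub>e u"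
    by (intro tendsto_intros approximates_energy U)
  ultimately show ?thesis using LIMSEQ_unique by blast
qed

lemma extended_energy_midpoint:
  assumes "u \<in> \<F>\<^sub>e" "v \<in> \<F>\<^sub>e"
  shows "\<E>\<^sub>e (\<lambda>x. (u x + v x) / 2) = (\<E>\<^sub>e u + \<E>\<^sub>e v) / 2 - \<E>\<^sub>e (\<lambda>x. u x - v x) / 4"
proof -
  obtain U where U: "approximates U u" "\<And>k. U k \<in> \<F>"
    using extended_domain_approximates[OF assms(1)] by blast
  obtain W where W: "approximates W v" "\<And>k. W k \<in> \<F>"
    using extended_domain_approximates[OF assms(2)] by blast
  have "approximates (\<lambda>k x. (U k x + W k x) / 2) (\<lambda>x. (u x + v x) / 2)"
    using approximates_scale[OF approximates_add[OF U(1) W(1)], of "1/2"] by simp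
  from approximates_energy[OF this]
  have "(\<lambda>k. (\<E> (U k) (U k) + \<E> (W k) (W k)) / 2 - \<E> (\<lambda>x. U k x - W k x) (\<lambda>x. U k x - W k x) / 4)
      \<longlonglongrightarrow> \<E>\<^sub>e (\<lambda>x. (u x + v x) / 2)"
    using U(2) W(2) by (simp add: form.quadratic_half)
  moreover have "(\<lambda>k. (\<E> (U k) (U k) + \<E> (W k) (W k)) / 2 - \<E> (\<lambda>x. U k x - W k x) (\<lambda>x. U k x - W k x) / 4)
      \<longlonglongrightarrow> (\<E>\<^sub>e u + \<E>\<^sub>e v) / 2 - \<E>\<^sub>e (\<lambda>x. u x - v x) / 4"
    by (intro tendsto_intros approximates_energy approximates_diff U W) auto
  ultimately show ?thesis using LIMSEQ_unique by blast
qed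

lemma extended_energy_triangle:
  assumes "u \<in> \<F>\<^sub>e" "v \<in> \<F>\<^sub>e"
  shows "sqrt (\<E>\<^sub>e (\<lambda>x. u x + v x)) \<le> sqrt (\<E>\<^sub>e u) + sqrt (\<E>\<^sub>e v)"
proof -
  obtain U where U: "approximates U u" "\<And>k. U k \<in> \<F>"
    using extended_domain_approximates[OF assms(1)] by blast
  obtain W where W: "approximates W v" "\<And>k. W k \<in> \<F>"
    using extended_domain_approximates[OF assms(2)] by blast
  show ?thesis
  proof (rule LIMSEQ_le)
    show "(\<lambda>k. seminorm (\<lambda>x. U k x + W k x)) \<longlonglongrightarrow> sqrt (\<E>\<^sub>e (\<lambda>x. u x + v x))"
      by (intro approximates_seminorm approximates_add U W)
    show "(\<lambda>k. seminorm (U k) + seminorm (W k)) \<longlonglongrightarrow> sqrt (\<E>\<^sub>e u) + sqrt (\<E>\<^sub>e v)"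
      by (intro tendsto_add approximates_seminorm U W)
  qed (use form.seminorm_add U W in blast)
qed

end

section \<open>The Euclidean combination of the two norms\<close>

text \<open>
  The parallelogram identity controls squares of norms, whereas uniform convexity of \<open>L\<^sup>q\<close> speaks of
  \<open>q\<close>-th powers. Uniform continuity of \<open>t \<mapsto> t powr (q / 2)\<close> on \<open>{0..1}\<close> passes from one to the other.
\<close>

lemma powr_mean_gap_small:
  fixes q \<tau> :: real
  assumes q: "1 < q" and \<tau>: "0 < \<tau>"
  shows "\<exists>d>0. \<forall>x y m. 0 \<le> x \<and> x \<le> 1 \<and> 0 \<le> y \<and> y \<le> 1 \<and> 0 \<le> m \<and> m \<le> 1 \<and>
    \<bar>x - y\<bar> \<le> d \<and> (x\<^sup>2 + y\<^sup>2) / 2 - d \<le> m\<^sup>2 \<longrightarrow> (x powr q + y powr q) / 2 - m powr q \<le> \<tau>"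
proof -
  have "continuous_on {0..1} (\<lambda>t::real. t powr (q / 2))"
    using q by (intro continuous_on_powr') (auto intro: continuous_intros)
  then have "uniformly_continuous_on {0..1} (\<lambda>t::real. t powr (q / 2))"
    by (rule compact_uniformly_continuous) simp
  then obtain r where r: "0 < r" and
    "\<forall>s\<in>{0..1}. \<forall>t\<in>{0..1}. dist t s < r \<longrightarrow> dist (t powr (q / 2)) (s powr (q / 2)) < \<tau>"
    using \<tau> unfolding uniformly_continuous_on_def by blast
  then have uc: "t powr (q / 2) - s powr (q / 2) \<le> \<tau>"
    if "0 \<le> s" "s \<le> 1" "0 \<le> t" "t \<le> 1" "t - s < r" for s t
  proof (cases "t \<le> s")
    case True
    then have "t powr (q / 2) \<le> s powr (q / 2)" using q that by (intro powr_mono2) auto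
    with \<tau> show ?thesis by simp
  next
    case False
    then have "dist (t powr (q / 2)) (s powr (q / 2)) < \<tau>"
      using that \<open>\<forall>s\<in>{0..1}. _ s\<close> by (auto simp: dist_real_def)
    then show ?thesis by (simp add: dist_real_def)
  qed
  have square: "t\<^sup>2 powr (q / 2) = t powr q" if "0 \<le> t" for t :: real
  proof -
    have "t\<^sup>2 = t powr 2" using that by simp
    then show ?thesis by (simp add: powr_powr del: powr_numeral)
  qed
  have one: "x powr q - m powr q \<le> \<tau>"
    if "0 \<le> x" "x \<le> 1" "0 \<le> y" "y \<le> 1" "0 \<le> m" "m \<le> 1" "\<bar>x - y\<bar> \<le> r / 3"
      "(x\<^sup>2 + y\<^sup>2) / 2 - r / 3 \<le> m\<^sup>2" for x y m
  proof -
    have "x\<^sup>2 - y\<^sup>2 = (x - y) * (x + y)" by (simp add: power2_eq_square algebra_simps)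
    also have "\<dots> \<le> \<bar>x - y\<bar> * 2" using that by (intro mult_mono) auto
    finally have "x\<^sup>2 - m\<^sup>2 < r" using that(7,8) r by argo
    moreover have "x\<^sup>2 \<le> 1" "m\<^sup>2 \<le> 1" using that by (auto intro: power_le_one)
    ultimately have "x\<^sup>2 powr (q / 2) - m\<^sup>2 powr (q / 2) \<le> \<tau>" by (intro uc) auto
    then show ?thesis using that by (simp add: square)
  qed
  have "(x powr q + y powr q) / 2 - m powr q \<le> \<tau>"
    if "0 \<le> x \<and> x \<le> 1 \<and> 0 \<le> y \<and> y \<le> 1 \<and> 0 \<le> m \<and> m \<le> 1 \<and>
      \<bar>x - y\<bar> \<le> r / 3 \<and> (x\<^sup>2 + y\<^sup>2) / 2 - r / 3 \<le> m\<^sup>2" for x y m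
  proof -
    have "x powr q - m powr q \<le> \<tau>" using that by (intro one[of x y m]) auto
    moreover have "y powr q - m powr q \<le> \<tau>"
      using that by (intro one[of y x m]) (auto simp: abs_minus_commute add.commute)
    ultimately show ?thesis by argo
  qed
  then show ?thesis using r by (intro exI[of _ "r / 3"]) auto
qed

context dirichlet_form
begin

lemma V_norm_power2:
  assumes "u \<in> V_space \<mu> \<F> \<E> q"
  shows "(V_norm \<mu> \<F> \<E> q u)\<^sup>2 = (Lq_norm \<mu> q u)\<^sup>2 + \<E>\<^sub>e u"
  using assms extended_energy_nonneg by (simp add: V_norm_def V_space_def)

text \<open>
  The norm is the Euclidean norm of the pair of the \<open>L\<^sup>q\<close>-norm and the square root of the energy;
  the triangle inequality is that of the plane, applied to the two triangle inequalities.
\<close>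

lemma V_space_normed:
  assumes q: "1 < q"
  shows "normed_function_space \<mu> (V_space \<mu> \<F> \<E> q) (V_norm \<mu> \<F> \<E> q)"
proof -
  let ?V = "V_space \<mu> \<F> \<E> q" and ?N = "V_norm \<mu> \<F> \<E> q"
  have sub: "u \<in> Lq_space \<mu> q" "u \<in> \<F>\<^sub>e" if "u \<in> ?V" for u using that by (auto simp: V_space_def)
  have "?V \<subseteq> borel_measurable \<mu>" by (auto simp: V_space_def Lq_space_def)
  moreover have "linear_function_space ?V"
    unfolding linear_function_space_def
    using extended_null(1)[of "\<lambda>x. 0"] q
    by (auto simp: V_space_def Lq_add Lq_scale extended_add extended_scale)
      (simp add: Lq_space_def)
  moreover have "0 \<le> ?N u" if "u \<in> ?V" for u
    using extended_energy_nonneg[OF sub(2)[OF that]] by (simp add: V_norm_def)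
  moreover have "?N u = 0 \<longleftrightarrow> (AE x in \<mu>. u x = 0)" if u: "u \<in> ?V" for u
  proof
    assume "?N u = 0"
    then have "Lq_norm \<mu> q u = 0"
      using extended_energy_nonneg[OF sub(2)[OF u]]
      by (simp add: V_norm_def add_nonneg_eq_0_iff)
    then show "AE x in \<mu>. u x = 0" using Lq_norm_eq_0_iff[OF q sub(1)[OF u]] by simp
  next
    assume ae: "AE x in \<mu>. u x = 0"
    then have "Lq_norm \<mu> q u = 0" using Lq_norm_eq_0_iff[OF q sub(1)[OF u]] by simp
    moreover have "\<E>\<^sub>e u = 0"
      using sub(1)[OF u] ae by (intro extended_null) (auto simp: Lq_space_def)
    ultimately show "?N u = 0" by (simp add: V_norm_def)
  qed
  moreover have "?N (\<lambda>x. c * u x) = \<bar>c\<bar> * ?N u" if u: "u \<in> ?V" for c u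
  proof -
    have "(Lq_norm \<mu> q (\<lambda>x. c * u x))\<^sup>2 + \<E>\<^sub>e (\<lambda>x. c * u x) = c\<^sup>2 * ((Lq_norm \<mu> q u)\<^sup>2 + \<E>\<^sub>e u)"
      by (simp add: Lq_norm_scale[OF q] extended_energy_scale[OF sub(2)[OF u]] power_mult_distrib
          distrib_left)
    then show ?thesis by (simp add: V_norm_def real_sqrt_mult)
  qed
  moreover have "?N (\<lambda>x. u x + v x) \<le> ?N u + ?N v" if u: "u \<in> ?V" and v: "v \<in> ?V" for u v
  proof -
    define a b where "a = sqrt (\<E>\<^sub>e u)" and "b = sqrt (\<E>\<^sub>e v)"
    have nn: "0 \<le> \<E>\<^sub>e u" "0 \<le> \<E>\<^sub>e v" "0 \<le> \<E>\<^sub>e (\<lambda>x. u x + v x)"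
      by (intro extended_energy_nonneg extended_add sub(2) u v)+
    have "\<E>\<^sub>e (\<lambda>x. u x + v x) = (sqrt (\<E>\<^sub>e (\<lambda>x. u x + v x)))\<^sup>2" using nn by simp
    also have "\<dots> \<le> (a + b)\<^sup>2"
      unfolding a_def b_def using u v nn
      by (intro power_mono extended_energy_triangle) (auto intro: sub(2))
    finally have "\<E>\<^sub>e (\<lambda>x. u x + v x) \<le> (a + b)\<^sup>2" .
    moreover have "(Lq_norm \<mu> q (\<lambda>x. u x + v x))\<^sup>2 \<le> (Lq_norm \<mu> q u + Lq_norm \<mu> q v)\<^sup>2"
      using u v by (intro power_mono Lq_norm_triangle q Lq_norm_nonneg) (auto intro: sub(1))
    ultimately have "?N (\<lambda>x. u x + v x) \<le> sqrt ((Lq_norm \<mu> q u + Lq_norm \<mu> q v)\<^sup>2 + (a + b)\<^sup>2)"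
      unfolding V_norm_def by (intro real_sqrt_le_mono add_mono)
    also have "\<dots> \<le> sqrt ((Lq_norm \<mu> q u)\<^sup>2 + a\<^sup>2) + sqrt ((Lq_norm \<mu> q v)\<^sup>2 + b\<^sup>2)"
      by (rule real_sqrt_sum_squares_triangle_ineq)
    also have "\<dots> = ?N u + ?N v" using nn by (simp add: V_norm_def a_def b_def)
    finally show ?thesis .
  qed
  ultimately show ?thesis unfolding normed_function_space_def by blast
qed

text \<open>
  For \<open>v\<close>, \<open>w\<close> of norm one, write \<open>x\<close>, \<open>y\<close>, \<open>m\<close> for the \<open>L\<^sup>q\<close>-norms of \<open>v\<close>, \<open>w\<close> and their midpoint. As \<open>m \<le> (x + y) / 2\<close>, the
  squared norm of the midpoint is at most \<open>1 - ((x - y) / 2)\<^sup>2 - \<E>(v - w) / 4\<close>. If it is almost one,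
  then \<open>\<E>(v - w)\<close> and \<open>x - y\<close> are small and \<open>m\<^sup>2\<close> is almost \<open>(x\<^sup>2 + y\<^sup>2) / 2\<close>, so
  \<open>Lq_norm_diff_le_gap\<close> bounds the \<open>L\<^sup>q\<close>-norm of \<open>v - w\<close>.
\<close>

lemma V_norm_midpoint_le:
  assumes q: "1 < q" and \<epsilon>: "0 < \<epsilon>"
  shows "\<exists>\<delta>>0. \<forall>v\<in>V_space \<mu> \<F> \<E> q. \<forall>w\<in>V_space \<mu> \<F> \<E> q.
    V_norm \<mu> \<F> \<E> q v = 1 \<and> V_norm \<mu> \<F> \<E> q w = 1 \<and> V_norm \<mu> \<F> \<E> q (\<lambda>x. v x - w x) > \<epsilon> \<longrightarrow>
    V_norm \<mu> \<F> \<E> q (\<lambda>x. (v x + w x) / 2) \<le> 1 - \<delta>"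
proof -
  let ?V = "V_space \<mu> \<F> \<E> q" and ?N = "V_norm \<mu> \<F> \<E> q" and ?L = "Lq_norm \<mu> q"
  \<comment> \<open>\<open>\<kappa>\<close> is the share of \<open>\<epsilon>\<^sup>2\<close> granted to the energy and to the squared \<open>L\<^sup>q\<close>-norm each, and \<open>\<rho>\<close>
    is the bound on the \<open>q\<close>-th power that corresponds to it; one half of \<open>\<rho>\<close> goes to the term with
    the small factor and one half to the convexity gap.\<close>
  define \<kappa> where "\<kappa> = \<epsilon>\<^sup>2 / 2"
  define \<rho> where "\<rho> = sqrt \<kappa> powr q"
  have \<kappa>: "0 < \<kappa>" using \<epsilon> by (simp add: \<kappa>_def)
  then have \<rho>: "0 < \<rho>" by (simp add: \<rho>_def)
  have "0 < \<rho> / 4" using \<rho> by simp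
  then obtain C where C: "0 \<le> C" and clarkson: "\<And>u v. \<lbrakk>u \<in> Lq_space \<mu> q; v \<in> Lq_space \<mu> q\<rbrakk> \<Longrightarrow>
      ?L (\<lambda>x. u x - v x) powr q \<le> \<rho> / 4 * (?L u powr q + ?L v powr q) +
      C * ((?L u powr q + ?L v powr q) / 2 - ?L (\<lambda>x. (u x + v x) / 2) powr q)"
    using Lq_norm_diff_le_gap[OF q, of "\<rho> / 4" \<mu>] by blast
  define \<tau> where "\<tau> = \<rho> / (2 * (C + 1))"
  have \<tau>: "0 < \<tau>" using \<rho> C by (simp add: \<tau>_def)
  obtain d where d: "0 < d" and gap: "\<And>x y m. \<lbrakk>0 \<le> x; x \<le> 1; 0 \<le> y; y \<le> 1; 0 \<le> m; m \<le> 1;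
      \<bar>x - y\<bar> \<le> d; (x\<^sup>2 + y\<^sup>2) / 2 - d \<le> m\<^sup>2\<rbrakk> \<Longrightarrow> (x powr q + y powr q) / 2 - m powr q \<le> \<tau>"
    using powr_mean_gap_small[OF q \<tau>] by blast
  \<comment> \<open>A loss of at most \<open>\<theta>\<close> in the squared norm of the midpoint forces \<open>\<E>(v - w) \<le> \<kappa>\<close>,
    \<open>\<bar>x - y\<bar> \<le> d\<close>, and a loss of at most \<open>d\<close> in the squared \<open>L\<^sup>q\<close>-norm.\<close>
  define \<theta> where "\<theta> = min (min 1 (\<kappa> / 4)) (min d ((d / 2)\<^sup>2))"
  have \<theta>: "0 < \<theta>" "\<theta> \<le> 1" "\<theta> \<le> \<kappa> / 4" "\<theta> \<le> d" "\<theta> \<le> (d / 2)\<^sup>2"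
    using \<kappa> d by (auto simp: \<theta>_def)
  have main: "?N (\<lambda>x. v x - w x) \<le> \<epsilon>"
    if v: "v \<in> ?V" and w: "w \<in> ?V" and Nv: "?N v = 1" and Nw: "?N w = 1"
      and mid: "1 - \<theta> / 2 < ?N (\<lambda>x. (v x + w x) / 2)" for v w
  proof -
    define x y m where "x = ?L v" and "y = ?L w" and "m = ?L (\<lambda>x. (v x + w x) / 2)"
    define s where "s = \<E>\<^sub>e (\<lambda>x. v x - w x)"
    have vL: "v \<in> Lq_space \<mu> q" and wL: "w \<in> Lq_space \<mu> q" and vE: "v \<in> \<F>\<^sub>e" and wE: "w \<in> \<F>\<^sub>e"
      using v w by (auto simp: V_space_def)
    have sum_mem: "(\<lambda>x. (v x + w x) / 2) \<in> ?V"
      using Lq_midpoint[OF q vL wL] extended_scale[OF extended_add[OF vE wE], of "1/2"]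
      by (simp add: V_space_def)
    have diff_mem: "(\<lambda>x. v x - w x) \<in> ?V"
      using Lq_diff[OF q vL wL] extended_add[OF vE extended_scale[OF wE, of "-1"]]
      by (simp add: V_space_def)
    have s: "0 \<le> s"
      unfolding s_def using diff_mem by (intro extended_energy_nonneg) (simp add: V_space_def)
    have nn: "0 \<le> x" "0 \<le> y" "0 \<le> m" by (simp_all add: x_def y_def m_def Lq_norm_nonneg)
    have one: "x\<^sup>2 + \<E>\<^sub>e v = 1" "y\<^sup>2 + \<E>\<^sub>e w = 1"
      using V_norm_power2[OF v] V_norm_power2[OF w] Nv Nw by (simp_all add: x_def y_def)
    then have "x\<^sup>2 \<le> 1\<^sup>2" "y\<^sup>2 \<le> 1\<^sup>2"
      using extended_energy_nonneg[OF vE] extended_energy_nonneg[OF wE] by simp_all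
    then have le1: "x \<le> 1" "y \<le> 1" by (simp_all add: power2_le_imp_le)
    have "?L (\<lambda>x. 1/2 * (v x + w x)) \<le> 1/2 * (x + y)"
      unfolding Lq_norm_scale[OF q] using Lq_norm_triangle[OF q vL wL] by (simp add: x_def y_def)
    then have m_le: "m \<le> (x + y) / 2" by (simp add: m_def)
    then have m1: "m \<le> 1" using le1 by simp
    have "m\<^sup>2 \<le> ((x + y) / 2)\<^sup>2" using m_le nn by (intro power_mono)
    also have "\<dots> = (x\<^sup>2 + y\<^sup>2) / 2 - ((x - y) / 2)\<^sup>2" by (simp add: power2_eq_square field_simps)
    finally have m2: "m\<^sup>2 \<le> (x\<^sup>2 + y\<^sup>2) / 2 - ((x - y) / 2)\<^sup>2" .
    have mid2: "(?N (\<lambda>x. (v x + w x) / 2))\<^sup>2 = m\<^sup>2 + (1 - (x\<^sup>2 + y\<^sup>2) / 2 - s / 4)"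
    proof -
      have "\<E>\<^sub>e v = 1 - x\<^sup>2" "\<E>\<^sub>e w = 1 - y\<^sup>2" using one by simp_all
      then show ?thesis
        unfolding V_norm_power2[OF sum_mem] extended_energy_midpoint[OF vE wE]
        by (simp add: m_def s_def field_simps)
    qed
    have "(1 - \<theta> / 2)\<^sup>2 \<le> (?N (\<lambda>x. (v x + w x) / 2))\<^sup>2"
      using mid \<theta> by (intro power_mono) auto
    moreover have "1 - \<theta> \<le> (1 - \<theta> / 2)\<^sup>2"
      using zero_le_power2[of "\<theta> / 2"] by (simp add: power2_eq_square algebra_simps)
    ultimately have low: "(x\<^sup>2 + y\<^sup>2) / 2 + s / 4 - \<theta> \<le> m\<^sup>2" unfolding mid2 by argo
    have "s / 4 + ((x - y) / 2)\<^sup>2 \<le> \<theta>" using low m2 by argo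
    then have s_le: "s \<le> \<kappa>" and "((x - y) / 2)\<^sup>2 \<le> (d / 2)\<^sup>2"
      using \<theta> s zero_le_power2[of "(x - y) / 2"] by argo+
    then have "\<bar>(x - y) / 2\<bar> \<le> \<bar>d / 2\<bar>" by (intro abs_le_square_iff[THEN iffD2])
    then have xy: "\<bar>x - y\<bar> \<le> d" using d by simp
    have "(x powr q + y powr q) / 2 - m powr q \<le> \<tau>"
      by (intro gap nn le1 m1 xy) (use low s \<theta> in argo)
    then have "C * ((x powr q + y powr q) / 2 - m powr q) \<le> C * \<tau>"
      using C by (rule mult_left_mono)
    also have "\<dots> \<le> \<rho> / 2"
      using C \<rho> by (simp add: \<tau>_def field_simps)
    finally have gap_le: "C * ((x powr q + y powr q) / 2 - m powr q) \<le> \<rho> / 2" .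
    have "x powr q \<le> 1 powr q" "y powr q \<le> 1 powr q"
      by (intro powr_mono2; use nn le1 q in simp)+
    then have "\<rho> / 4 * (x powr q + y powr q) \<le> \<rho> / 4 * 2"
      using \<rho> by (intro mult_left_mono) auto
    then have "?L (\<lambda>x. v x - w x) powr q \<le> sqrt \<kappa> powr q"
      using clarkson[OF vL wL] gap_le by (simp add: x_def y_def m_def flip: \<rho>_def)
    then have "?L (\<lambda>x. v x - w x) \<le> sqrt \<kappa>"
    proof (rule contrapos_pp)
      assume "\<not> ?L (\<lambda>x. v x - w x) \<le> sqrt \<kappa>"
      then have "sqrt \<kappa> powr q < ?L (\<lambda>x. v x - w x) powr q"
        using q \<kappa> by (intro powr_less_mono2) auto
      then show "\<not> ?L (\<lambda>x. v x - w x) powr q \<le> sqrt \<kappa> powr q" by simp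
    qed
    then have "(?L (\<lambda>x. v x - w x))\<^sup>2 \<le> (sqrt \<kappa>)\<^sup>2"
      by (intro power_mono Lq_norm_nonneg)
    moreover have "(sqrt \<kappa>)\<^sup>2 = \<kappa>" using \<kappa> by simp
    moreover have "(?N (\<lambda>x. v x - w x))\<^sup>2 = (?L (\<lambda>x. v x - w x))\<^sup>2 + s"
      unfolding s_def by (rule V_norm_power2[OF diff_mem])
    moreover have "\<kappa> + \<kappa> = \<epsilon>\<^sup>2" unfolding \<kappa>_def by (rule field_sum_of_halves)
    ultimately have "(?N (\<lambda>x. v x - w x))\<^sup>2 \<le> \<epsilon>\<^sup>2" using s_le by linarith
    then show ?thesis by (rule power2_le_imp_le) (use \<epsilon> in linarith)
  qed
  show ?thesis
  proof (intro exI[of _ "\<theta> / 2"] conjI ballI impI)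
    fix v w assume "v \<in> ?V" "w \<in> ?V" and "?N v = 1 \<and> ?N w = 1 \<and> ?N (\<lambda>x. v x - w x) > \<epsilon>"
    then show "?N (\<lambda>x. (v x + w x) / 2) \<le> 1 - \<theta> / 2"
      using main[of v w] by (meson not_le)
  qed (use \<theta> in simp)
qed

end

theorem proposition3p3:
  fixes \<mu> :: "'a::metric_space measure"
    and \<F> :: "('a \<Rightarrow> real) set"
    and \<E> :: "('a \<Rightarrow> real) \<Rightarrow> ('a \<Rightarrow> real) \<Rightarrow> real"
    and q :: real
  assumes "metric_measure_space \<mu>"
    and "dirichlet_form \<mu> \<F> \<E>"
    and "1 < q"
  shows "uniformly_convex_function_space \<mu> (V_space \<mu> \<F> \<E> q) (V_norm \<mu> \<F> \<E> q)"
proof -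
  interpret dirichlet_form \<mu> \<F> \<E> by fact
  show ?thesis
    unfolding uniformly_convex_function_space_def
    using V_space_normed[OF \<open>1 < q\<close>] V_norm_midpoint_le[OF \<open>1 < q\<close>] by blast
qed

end
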